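(* Let $(\mathfrak{l},\mathfrak{h},\mathfrak{g};\tilde\beta,\tilde\alpha,\widetilde{\vartriangleright},\{,\})$ be a differential 2-crossed module (2-crossed module of Lie algebras), let $M$ be a smooth manifold of dimension $d\ge 4$, and let $(A,B,C)$ be any 3-connection on $M$, i.e. $A\in\Lambda^1(M,\mathfrak{g})$, $B\in\Lambda^2(M,\mathfrak{h})$, $C\in\Lambda^3(M,\mathfrak{l})$. Put $$F_1:=dA+A\wedge A-\tilde\alpha(B),\qquad F_2:=dB+A\wedge^{\widetilde{\vartriangleright}}B-\tilde\beta(C),\qquad \Omega_3:=dC+A\wedge^{\widetilde{\vartriangleright}}C+B\wedge^{\{,\}}B.$$ Then the following identities (3-Bianchi-Identities) hold: $$dF_1+A\wedge^{[,]}F_1=-\tilde\alpha(F_2),$$ $$dF_2+A\wedge^{\widetilde{\vartriangleright}}F_2=(F_1+\tilde\alpha(B))\wedge^{\widetilde{\vartriangleright}}B-\tilde\beta\big(\Omega_3-B\wedge^{\{,\}}B\big),$$ $$d\Omega_3+A\wedge^{\widetilde{\vartriangleright}}\Omega_3=(F_1+\tilde\alpha(B))\wedge^{\widetilde{\vartriangleright}}C+(F_2+\tilde\beta(C))\wedge^{\{,\}}B+B\wedge^{\{,\}}(F_2+\tilde\beta(C)).$$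
   Context: A differential 2-crossed module $(\mathfrak{l},\mathfrak{h},\mathfrak{g};\tilde\beta,\tilde\alpha,\widetilde{\vartriangleright},\{,\})$ consists of finite-dimensional Lie algebras and Lie algebra maps $\mathfrak{l}\xrightarrow{\tilde\beta}\mathfrak{h}\xrightarrow{\tilde\alpha}\mathfrak{g}$ with $\tilde\alpha\tilde\beta=0$; a left action $\widetilde{\vartriangleright}$ of $\mathfrak{g}$ by derivations on $\mathfrak{l}$, on $\mathfrak{h}$, and on $\mathfrak{g}$ by the adjoint action, for which $\tilde\alpha,\tilde\beta$ are equivariant, i.e. $\tilde\alpha(X\widetilde{\vartriangleright}Y)=[X,\tilde\alpha(Y)]$ and $\tilde\beta(X\widetilde{\vartriangleright}Z)=X\widetilde{\vartriangleright}\tilde\beta(Z)$; and a bilinear map $\{,\}:\mathfrak{h}\times\mathfrak{h}\to\mathfrak{l}$ (Peiffer lifting) that is $\mathfrak{g}$-equivariant, $X\widetilde{\vartriangleright}\{Y_1,Y_2\}=\{X\widetilde{\vartriangleright}Y_1,Y_2\}+\{Y_1,X\widetilde{\vartriangleright}Y_2\}$, and satisfies, for all $Y,Y_i\in\mathfrak{h}$, $Z,Z_i\in\mathfrak{l}$: (1) $\tilde\beta\{Y_1,Y_2\}=[Y_1,Y_2]-\tilde\alpha(Y_1)\widetilde{\vartriangleright}Y_2$; (2) $[Z_1,Z_2]=\{\tilde\beta(Z_1),\tilde\beta(Z_2)\}$; (3) $\{[Y_1,Y_2],Y_3\}=\tilde\alpha(Y_1)\widetilde{\vartriangleright}\{Y_2,Y_3\}+\{Y_1,[Y_2,Y_3]\}-\tilde\alpha(Y_2)\widetilde{\vartriangleright}\{Y_1,Y_3\}-\{Y_2,[Y_1,Y_3]\}$;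 (4) $\{Y_1,[Y_2,Y_3]\}=\{\tilde\beta\{Y_1,Y_2\},Y_3\}-\{\tilde\beta\{Y_1,Y_3\},Y_2\}$; (5) $\{\tilde\beta(Z),Y\}+\{Y,\tilde\beta(Z)\}=-\tilde\alpha(Y)\widetilde{\vartriangleright}Z$. $\Lambda^k(M,\mathfrak{w})$ denotes smooth $\mathfrak{w}$-valued differential $k$-forms on $M$. Write a form as $A=\sum_a A^aX_a$ with scalar forms $A^a$ and Lie algebra elements $X_a$. Exterior derivative $d$ and linear maps act in components: $dA=\sum_a dA^a\,X_a$, $\tilde\alpha(B)=\sum_a B^a\tilde\alpha(Y_a)$, $\tilde\beta(C)=\sum_a C^a\tilde\beta(Z_a)$. Products: $A\wedge A'=\sum_{a,b}A^a\wedge A'^b\,X_aX_b$, $A\wedge^{[,]}A'=\sum_{a,b}A^a\wedge A'^b[X_a,X_b]$, $A\wedge^{\widetilde{\vartriangleright}}W=\sum_{a,b}A^a\wedge W^b\,X_a\widetilde{\vartriangleright}W_b$ for $W$ with values in $\mathfrak{g}$, $\mathfrak{h}$ or $\mathfrak{l}$, and $B\wedge^{\{,\}}B'=\sum_{a,b}B^a\wedge B'^b\{Y_a,Y_b\}$. For a $\mathfrak{g}$-valued 1-form $A$, $A\wedge A=\tfrac12 A\wedge^{[,]}A$ (which is the meaning of $A\wedge A$ when $\mathfrak{g}$ is not given as a matrix algebra). *)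

theory Defs
  imports
    "HOL-Analysis.Analysis"
    "HOL-Combinatorics.Permutations"
    "HOL-Library.Function_Algebras"
begin

section \<open>Differential 2-crossed modules\<close>

text \<open>
  A finite-dimensional real Lie algebra lives on a whole type of class
  \<^class>\<open>real_normed_vector\<close>. The norm only fixes the topology needed to differentiate; on a
  finite-dimensional space all norms are equivalent. The class \<^class>\<open>euclidean_space\<close> is not used
  because it excludes the zero Lie algebra.
\<close>

locale lie_algebra =
  fixes bracket :: "'a::real_normed_vector \<Rightarrow> 'a \<Rightarrow> 'a"
  assumes finite_dimensional: "\<exists>S::'a set. finite S \<and> span S = UNIV"
    and bilinear_bracket: "bilinear bracket"
    and bracket_self: "bracket x x = 0"
    and jacobi: "bracket x (bracket y z) + bracket y (bracket z x) + bracket z (bracket x y) = 0"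

definition lie_hom ::
  "('a::real_normed_vector \<Rightarrow> 'a \<Rightarrow> 'a) \<Rightarrow> ('b::real_normed_vector \<Rightarrow> 'b \<Rightarrow> 'b) \<Rightarrow> ('a \<Rightarrow> 'b) \<Rightarrow> bool"
  where "lie_hom br br' f \<longleftrightarrow> linear f \<and> (\<forall>x y. f (br x y) = br' (f x) (f y))"

definition lie_action_by_derivations ::
  "('g::real_normed_vector \<Rightarrow> 'g \<Rightarrow> 'g) \<Rightarrow> ('a::real_normed_vector \<Rightarrow> 'a \<Rightarrow> 'a) \<Rightarrow> ('g \<Rightarrow> 'a \<Rightarrow> 'a) \<Rightarrow> bool"
  where "lie_action_by_derivations br_g br act \<longleftrightarrow>
    bilinear act \<and>
    (\<forall>X X' Y. act (br_g X X') Y = act X (act X' Y) - act X' (act X Y)) \<and>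
    (\<forall>X Y Y'. act X (br Y Y') = br (act X Y) Y' + br Y (act X Y'))"

text \<open>The action of \<open>\<gg>\<close> on itself is the adjoint action, that is, \<open>lie_g\<close>.\<close>

locale differential_2_crossed_module =
  L: lie_algebra lie_l + H: lie_algebra lie_h + G: lie_algebra lie_g
  for lie_l :: "'l::real_normed_vector \<Rightarrow> 'l \<Rightarrow> 'l"
    and lie_h :: "'h::real_normed_vector \<Rightarrow> 'h \<Rightarrow> 'h"
    and lie_g :: "'g::real_normed_vector \<Rightarrow> 'g \<Rightarrow> 'g" +
  fixes \<beta> :: "'l \<Rightarrow> 'h"
    and \<alpha> :: "'h \<Rightarrow> 'g"
    and act_l :: "'g \<Rightarrow> 'l \<Rightarrow> 'l"
    and act_h :: "'g \<Rightarrow> 'h \<Rightarrow> 'h"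
    and peiffer :: "'h \<Rightarrow> 'h \<Rightarrow> 'l"
  assumes hom_\<beta>: "lie_hom lie_l lie_h \<beta>"
    and hom_\<alpha>: "lie_hom lie_h lie_g \<alpha>"
    and \<alpha>_\<beta>: "\<alpha> (\<beta> Z) = 0"
    and action_l: "lie_action_by_derivations lie_g lie_l act_l"
    and action_h: "lie_action_by_derivations lie_g lie_h act_h"
    and equivariant_\<alpha>: "\<alpha> (act_h X Y) = lie_g X (\<alpha> Y)"
    and equivariant_\<beta>: "\<beta> (act_l X Z) = act_h X (\<beta> Z)"
    and bilinear_peiffer: "bilinear peiffer"
    and equivariant_peiffer:
      "act_l X (peiffer Y1 Y2) = peiffer (act_h X Y1) Y2 + peiffer Y1 (act_h X Y2)"
    and \<beta>_peiffer: "\<beta> (peiffer Y1 Y2) = lie_h Y1 Y2 - act_h (\<alpha> Y1) Y2"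
    and bracket_l: "lie_l Z1 Z2 = peiffer (\<beta> Z1) (\<beta> Z2)"
    and peiffer_bracket_left:
      "peiffer (lie_h Y1 Y2) Y3 =
        act_l (\<alpha> Y1) (peiffer Y2 Y3) + peiffer Y1 (lie_h Y2 Y3)
        - act_l (\<alpha> Y2) (peiffer Y1 Y3) - peiffer Y2 (lie_h Y1 Y3)"
    and peiffer_bracket_right:
      "peiffer Y1 (lie_h Y2 Y3) = peiffer (\<beta> (peiffer Y1 Y2)) Y3 - peiffer (\<beta> (peiffer Y1 Y3)) Y2"
    and peiffer_\<beta>: "peiffer (\<beta> Z) Y + peiffer Y (\<beta> Z) = - act_l (\<alpha> Y) Z"


section \<open>Smooth manifolds\<close>

primrec Ck_on :: "nat \<Rightarrow> 'a::real_normed_vector set \<Rightarrow> ('a \<Rightarrow> 'b::real_normed_vector) \<Rightarrow> bool"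
  where
    "Ck_on 0 S f \<longleftrightarrow> continuous_on S f"
  | "Ck_on (Suc n) S f \<longleftrightarrow>
      (\<forall>x\<in>S. f differentiable (at x)) \<and> (\<forall>v. Ck_on n S (\<lambda>x. frechet_derivative f (at x) v))"

text \<open>To be used for open \<open>S\<close> in a finite-dimensional space only.\<close>

definition smooth_on :: "'a::real_normed_vector set \<Rightarrow> ('a \<Rightarrow> 'b::real_normed_vector) \<Rightarrow> bool"
  where "smooth_on S f \<longleftrightarrow> (\<forall>n. Ck_on n S f)"

text \<open>A chart is a pair of its domain and its coordinate map (irrelevant outside the domain).\<close>

type_synonym ('m, 'e) chart = "'m set \<times> ('m \<Rightarrow> 'e)"

definition chart_image :: "('m, 'e) chart \<Rightarrow> 'e set"
  where "chart_image c = snd c ` fst c"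

definition transition :: "('m, 'e) chart \<Rightarrow> ('m, 'e) chart \<Rightarrow> 'e \<Rightarrow> 'e"
  where "transition c c' = snd c' \<circ> inv_into (fst c) (snd c)"

locale smooth_manifold =
  fixes X :: "'m topology"
    and \<A> :: "('m, 'e::euclidean_space) chart set"
  assumes Hausdorff: "Hausdorff_space X"
    and second_countable: "second_countable X"
    and chart_domain_open: "c \<in> \<A> \<Longrightarrow> openin X (fst c)"
    and chart_image_open: "c \<in> \<A> \<Longrightarrow> open (chart_image c)"
    and chart_homeomorphic:
      "c \<in> \<A> \<Longrightarrow> homeomorphic_map (subtopology X (fst c)) (top_of_set (chart_image c)) (snd c)"
    and charts_cover: "(\<Union>c\<in>\<A>. fst c) = topspace X"
    and transition_smooth:
      "c \<in> \<A> \<Longrightarrow> c' \<in> \<A> \<Longrightarrow> smooth_on (snd c ` (fst c \<inter> fst c')) (transition c c')"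


section \<open>Vector-valued differential forms\<close>

text \<open>
  The arguments of a \<open>k\<close>-linear form are the first \<open>k\<close> entries of a sequence of vectors.
\<close>

definition alternating_form ::
  "nat \<Rightarrow> ((nat \<Rightarrow> 'e::real_vector) \<Rightarrow> 'w::real_vector) \<Rightarrow> bool"
  where "alternating_form k \<eta> \<longleftrightarrow>
    (\<forall>v v'. (\<forall>i<k. v i = v' i) \<longrightarrow> \<eta> v = \<eta> v') \<and>
    (\<forall>v. \<forall>i<k. linear (\<lambda>u. \<eta> (v(i := u)))) \<and>
    (\<forall>v. \<forall>i<k. \<forall>j<k. i \<noteq> j \<longrightarrow> v i = v j \<longrightarrow> \<eta> v = 0)"

text \<open>
  A form on a manifold is the family of its coordinate expressions: \<open>\<omega> c x v\<close> is the value, at the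
  point with coordinates \<open>x\<close> in the chart \<open>c\<close>, on the tangent vectors with components \<open>v\<close> in that
  chart. The expressions in two charts are related by pullback along the transition map. The values
  of \<open>\<omega> c x\<close> are irrelevant unless \<open>c\<close> is in the atlas and \<open>x\<close> in its image, so that equality of
  forms is the relation \<open>form_eq\<close> below.
\<close>

type_synonym ('m, 'e, 'w) form = "('m, 'e) chart \<Rightarrow> 'e \<Rightarrow> (nat \<Rightarrow> 'e) \<Rightarrow> 'w"

definition differential_form ::
  "('m, 'e::euclidean_space) chart set \<Rightarrow> nat \<Rightarrow> ('m, 'e, 'w::real_normed_vector) form \<Rightarrow> bool"
  where "differential_form \<A> k \<omega> \<longleftrightarrow>
    (\<forall>c\<in>\<A>. \<forall>x\<in>chart_image c. alternating_form k (\<omega> c x)) \<and>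
    (\<forall>c\<in>\<A>. \<forall>v. smooth_on (chart_image c) (\<lambda>x. \<omega> c x v)) \<and>
    (\<forall>c\<in>\<A>. \<forall>c'\<in>\<A>. \<forall>p\<in>fst c \<inter> fst c'. \<forall>v.
      \<omega> c (snd c p) v =
      \<omega> c' (snd c' p) (\<lambda>i. frechet_derivative (transition c c') (at (snd c p)) (v i)))"

definition form_eq ::
  "('m, 'e) chart set \<Rightarrow> ('m, 'e, 'w) form \<Rightarrow> ('m, 'e, 'w) form \<Rightarrow> bool"
  where "form_eq \<A> \<omega> \<eta> \<longleftrightarrow> (\<forall>c\<in>\<A>. \<forall>x\<in>chart_image c. \<omega> c x = \<eta> c x)"

definition form_map :: "('v \<Rightarrow> 'w) \<Rightarrow> ('m, 'e, 'v) form \<Rightarrow> ('m, 'e, 'w) form"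
  where "form_map f \<omega> = (\<lambda>c x v. f (\<omega> c x v))"

definition omit :: "nat \<Rightarrow> (nat \<Rightarrow> 'a) \<Rightarrow> nat \<Rightarrow> 'a"
  where "omit i v = (\<lambda>j. if j < i then v j else v (Suc j))"

text \<open>
  The exterior derivative of a \<open>k\<close>-form, in coordinates. The coordinate vector fields \<open>v i\<close> are
  constant, so that the bracket terms of the invariant formula vanish.
\<close>

definition ext_deriv ::
  "nat \<Rightarrow> ('m, 'e::euclidean_space, 'w::real_normed_vector) form \<Rightarrow> ('m, 'e, 'w) form"
  where "ext_deriv k \<omega> = (\<lambda>c x v.
    \<Sum>i\<le>k. (- 1) ^ i *\<^sub>R frechet_derivative (\<lambda>y. \<omega> c y (omit i v)) (at x) (v i))"

text \<open>
  \<open>wedge m p q \<omega> \<eta>\<close> is the product of a \<open>p\<close>-form and a \<open>q\<close>-form along the bilinear map \<open>m\<close>. For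
  \<open>\<omega> = \<Sum>a. \<omega>\<^sup>a X\<^sub>a\<close> and \<open>\<eta> = \<Sum>b. \<eta>\<^sup>b Y\<^sub>b\<close> it is \<open>\<Sum>a b. (\<omega>\<^sup>a \<and> \<eta>\<^sup>b) m(X\<^sub>a, Y\<^sub>b)\<close>, where the wedge product
  of scalar forms is normalised by \<open>(\<xi> \<and> \<zeta>)(u, v) = \<xi>(u) \<zeta>(v) - \<xi>(v) \<zeta>(u)\<close> for 1-forms.
\<close>

definition wedge ::
  "('u \<Rightarrow> 'v \<Rightarrow> 'w::real_vector) \<Rightarrow> nat \<Rightarrow> nat \<Rightarrow>
    ('m, 'e, 'u) form \<Rightarrow> ('m, 'e, 'v) form \<Rightarrow> ('m, 'e, 'w) form"
  where "wedge m p q \<omega> \<eta> = (\<lambda>c x v.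
    (1 / (fact p * fact q)) *\<^sub>R
      (\<Sum>\<sigma> | \<sigma> permutes {..<p + q}.
        of_int (sign \<sigma>) *\<^sub>R m (\<omega> c x (\<lambda>i. v (\<sigma> i))) (\<eta> c x (\<lambda>i. v (\<sigma> (p + i))))))"

end

theory Submission
  imports Defs
begin

text \<open>
  In a chart, write \<open>alternate n T\<close> for the signed sum of \<open>T\<close> over all permutations of its first \<open>n\<close>
  arguments. Then a wedge product is a multiple of \<open>alternate\<close> of a product, and splitting a
  permutation of \<open>{..k}\<close> according to the image of \<open>0\<close> shows that the exterior derivative of
  \<open>alternate k \<omega>\<close> is \<open>alternate (k + 1)\<close> of the full derivative of \<open>\<omega>\<close>. Since \<open>alternate\<close> absorbs
  inner alternations and changes by a sign under permutation of the arguments, the Leibniz rule,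
  \<open>d \<circ> d = 0\<close> (symmetry of second derivatives) and the associativity and derivation rules for nested
  wedge products along bilinear maps all become pointwise identities. In the Bianchi identities the
  terms \<open>A \<and> dA\<close>, \<open>A \<and> dB\<close> and \<open>A \<and> dC\<close> then cancel, and what remains is: the Jacobi identity for
  \<open>A \<and> (A \<and> A)\<close>, the action property for \<open>A \<and> (A \<and> B)\<close> and \<open>A \<and> (A \<and> C)\<close>, equivariance of
  \<open>\<alpha>\<close> and \<open>\<beta>\<close>, \<open>\<alpha> \<circ> \<beta> = 0\<close>, and equivariance of the Peiffer lifting for \<open>A \<and> (B \<and> B)\<close>.
\<close>

section \<open>Linear maps on finite-dimensional normed spaces\<close>

text \<open>Induction on the basis. A new vector \<open>t\<close> outside \<open>span S\<close> has
  positive distance to that span; this distance bounds the coefficient of \<open>t\<close>, and the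
  induction hypothesis then bounds the others. It is the source of all continuity statements below,
  since the norm on the Lie algebras is arbitrary.\<close>

lemma coefficients_bounded:
  fixes S :: "'a::real_normed_vector set"
  assumes "finite S" "independent S"
  shows "\<exists>K\<ge>0. \<forall>u. (\<Sum>b\<in>S. \<bar>u b\<bar>) \<le> K * norm (\<Sum>b\<in>S. u b *\<^sub>R b)"
  using assms
proof (induction S rule: finite_induct)
  case empty
  then show ?case by auto
next
  case (insert t S)
  have indS: "independent S" and t: "t \<notin> span S"
    using insert.prems insert.hyps by (auto simp: independent_insert)
  then obtain K where K0: "K \<ge> 0"
    and K: "\<And>u. (\<Sum>b\<in>S. \<bar>u b\<bar>) \<le> K * norm (\<Sum>b\<in>S. u b *\<^sub>R b)"
    using insert.IH by blast
  \<comment> \<open>Otherwise some sequence in \<open>span S\<close> tends to \<open>t\<close>. By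
    the induction hypothesis its coefficients are Cauchy, hence convergent, and the limit
    \<open>t\<close> would lie in \<open>span S\<close>.\<close>
  have "\<exists>d>0. \<forall>s\<in>span S. d \<le> norm (t - s)"
  proof (rule ccontr)
    assume "\<not> ?thesis"
    then have "\<exists>s\<in>span S. norm (t - s) < inverse (real (Suc n))" for n
      by (metis inverse_positive_iff_positive not_le of_nat_0_less_iff zero_less_Suc)
    then obtain s where s: "\<And>n. s n \<in> span S" "\<And>n. norm (t - s n) < inverse (real (Suc n))"
      by metis
    have "\<exists>u. s n = (\<Sum>b\<in>S. u b *\<^sub>R b)" for n
      using s(1)[of n] insert.hyps(1) by (auto simp: span_finite)
    then obtain u where u: "\<And>n. s n = (\<Sum>b\<in>S. u n b *\<^sub>R b)"
      by metis
    have "(\<lambda>n. t - s n) \<longlonglongrightarrow> 0"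
      using s(2) by (intro LIMSEQ_norm_0) (simp add: inverse_eq_divide)
    then have lim_s: "s \<longlonglongrightarrow> t"
      using tendsto_diff[OF tendsto_const[of t], of "\<lambda>n. t - s n" 0 sequentially] by simp
    have "convergent (\<lambda>n. u n b)" if b: "b \<in> S" for b
    proof -
      have "\<bar>u n b - u m b\<bar> \<le> K * norm (s n - s m)" for m n
      proof -
        have "\<bar>u n b - u m b\<bar> \<le> (\<Sum>b\<in>S. \<bar>u n b - u m b\<bar>)"
          using b insert.hyps(1) by (intro member_le_sum) auto
        also have "\<dots> \<le> K * norm (s n - s m)"
          using K[of "\<lambda>b. u n b - u m b"] by (simp add: u scaleR_diff_left sum_subtractf)
        finally show ?thesis .
      qed
      \<comment> \<open>\<open>K\<close> may be zero; \<open>K + 1\<close> can be divided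
        by.\<close>
      then have le: "norm (u n b - u m b) \<le> (K + 1) * norm (s n - s m)" for m n
        by (smt (verit) mult_right_mono norm_ge_zero real_norm_def)
      have "Cauchy (\<lambda>n. u n b)"
      proof (rule CauchyI)
        fix e :: real assume "e > 0"
        then have "e / (K + 1) > 0" using K0 by simp
        then obtain M where "\<forall>m\<ge>M. \<forall>n\<ge>M. norm (s m - s n) < e / (K + 1)"
          using CauchyD[OF LIMSEQ_imp_Cauchy[OF lim_s]] by blast
        then have "\<forall>m\<ge>M. \<forall>n\<ge>M. (K + 1) * norm (s m - s n) < e"
          using K0 by (simp add: pos_less_divide_eq mult.commute)
        then show "\<exists>M. \<forall>m\<ge>M. \<forall>n\<ge>M. norm (u m b - u n b) < e"
          using le le_less_trans by blast
      qed
      then show ?thesis by (rule Cauchy_convergent)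
    qed
    then have "(\<lambda>n. u n b) \<longlonglongrightarrow> lim (\<lambda>n. u n b)" if "b \<in> S" for b
      using that convergent_LIMSEQ_iff by blast
    then have "s \<longlonglongrightarrow> (\<Sum>b\<in>S. lim (\<lambda>n. u n b) *\<^sub>R b)"
      unfolding u by (intro tendsto_sum tendsto_scaleR tendsto_const) auto
    then have "t = (\<Sum>b\<in>S. lim (\<lambda>n. u n b) *\<^sub>R b)"
      using lim_s LIMSEQ_unique by blast
    then show False
      using t by (metis (no_types, lifting) span_base span_scale span_sum)
  qed
  then obtain d where d: "d > 0" "\<And>s. s \<in> span S \<Longrightarrow> d \<le> norm (t - s)"
    by blast
  \<comment> \<open>The first summand collects the multiples of the coefficient of \<open>t\<close>,
    itself at most \<open>inverse d * norm x\<close>; the last \<open>K\<close> is the share of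
    \<open>norm x\<close> in the bound for \<open>w = x - u t *\<^sub>R t\<close>.\<close>
  define K' where "K' = inverse d * (1 + K * norm t) + K"
  have "(\<Sum>b\<in>insert t S. \<bar>u b\<bar>) \<le> K' * norm (\<Sum>b\<in>insert t S. u b *\<^sub>R b)" for u
  proof -
    define w where "w = (\<Sum>b\<in>S. u b *\<^sub>R b)"
    define x where "x = u t *\<^sub>R t + w"
    have w: "w \<in> span S"
      unfolding w_def by (intro span_sum span_scale span_base)
    \<comment> \<open>Division by \<open>u t\<close> turns \<open>x\<close> into \<open>t\<close>
      minus an element of \<open>span S\<close>, which has norm at least \<open>d\<close>.\<close>
    have "\<bar>u t\<bar> * d \<le> norm x"
    proof (cases "u t = 0")
      case False
      have "d \<le> norm (t - (- (1 / u t)) *\<^sub>R w)"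
        using w by (intro d(2) span_scale)
      then have "\<bar>u t\<bar> * d \<le> norm (u t *\<^sub>R (t - (- (1 / u t)) *\<^sub>R w))"
        by (simp add: mult_left_mono)
      also have "u t *\<^sub>R (t - (- (1 / u t)) *\<^sub>R w) = x"
        using False by (simp add: x_def scaleR_add_right)
      finally show ?thesis .
    qed simp
    then have ut: "\<bar>u t\<bar> \<le> inverse d * norm x"
      using d(1) by (simp add: field_simps)
    have "norm w \<le> norm x + \<bar>u t\<bar> * norm t"
      unfolding x_def by (metis add_diff_cancel_left' norm_scaleR norm_triangle_ineq4)
    then have "(\<Sum>b\<in>S. \<bar>u b\<bar>) \<le> K * (norm x + \<bar>u t\<bar> * norm t)"
      using K[of u] K0 unfolding w_def[symmetric] by (meson mult_left_mono order_trans)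
    then have "\<bar>u t\<bar> + (\<Sum>b\<in>S. \<bar>u b\<bar>) \<le> \<bar>u t\<bar> * (1 + K * norm t) + K * norm x"
      by (simp add: algebra_simps)
    also have "\<dots> \<le> inverse d * norm x * (1 + K * norm t) + K * norm x"
      using ut K0 by (intro add_right_mono mult_right_mono) auto
    also have "\<dots> = K' * norm x"
      by (simp add: K'_def algebra_simps)
    finally show ?thesis
      using insert.hyps by (simp add: x_def w_def)
  qed
  moreover have "K' \<ge> 0"
    using d(1) K0 by (simp add: K'_def)
  ultimately show ?case by blast
qed

lemma finite_dimensional_coordinates:
  assumes "\<exists>S::'a::real_normed_vector set. finite S \<and> span S = UNIV"
  obtains S :: "'a::real_normed_vector set" and K where "finite S"
    and "\<And>x. \<exists>u. x = (\<Sum>b\<in>S. u b *\<^sub>R b) \<and> (\<Sum>b\<in>S. \<bar>u b\<bar>) \<le> K * norm x"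
proof -
  obtain T :: "'a set" where T: "finite T" "span T = UNIV"
    using assms by blast
  obtain S where S: "S \<subseteq> T" "independent S" "T \<subseteq> span S"
    using maximal_independent_subset by blast
  have fin: "finite S"
    using S(1) T(1) finite_subset by blast
  have "span S = UNIV"
    using S(3) T(2) by (metis span_mono span_span top.extremum_uniqueI)
  then have ex: "\<exists>u. x = (\<Sum>b\<in>S. u b *\<^sub>R b)" for x
    using span_finite[OF fin] by (metis (no_types, lifting) UNIV_I imageE)
  obtain K where "\<And>u. (\<Sum>b\<in>S. \<bar>u b\<bar>) \<le> K * norm (\<Sum>b\<in>S. u b *\<^sub>R b)"
    using coefficients_bounded[OF fin S(2)] by blast
  then have "\<exists>u. x = (\<Sum>b\<in>S. u b *\<^sub>R b) \<and> (\<Sum>b\<in>S. \<bar>u b\<bar>) \<le> K * norm x" for x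
    using ex[of x] by auto
  then show ?thesis
    using that[OF fin] by blast
qed

lemma finite_dimensional_bounded_linear:
  fixes f :: "'a::real_normed_vector \<Rightarrow> 'b::real_normed_vector"
  assumes "\<exists>S::'a set. finite S \<and> span S = UNIV" and "linear f"
  shows "bounded_linear f"
proof -
  obtain S :: "'a set" and K where S: "finite S"
    "\<And>x. \<exists>u. x = (\<Sum>b\<in>S. u b *\<^sub>R b) \<and> (\<Sum>b\<in>S. \<bar>u b\<bar>) \<le> K * norm x"
    using finite_dimensional_coordinates[OF assms(1)] by blast
  interpret linear f by fact
  define M where "M = (\<Sum>b\<in>S. norm (f b))"
  have "norm (f x) \<le> norm x * (K * M)" for x
  proof -
    obtain u where u: "x = (\<Sum>b\<in>S. u b *\<^sub>R b)" "(\<Sum>b\<in>S. \<bar>u b\<bar>) \<le> K * norm x"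
      using S(2) by blast
    have "norm (f x) \<le> (\<Sum>b\<in>S. \<bar>u b\<bar> * norm (f b))"
      unfolding u(1) sum scale by (rule sum_norm_le) simp
    also have "\<dots> \<le> (\<Sum>b\<in>S. \<bar>u b\<bar> * M)"
      unfolding M_def using S(1) by (intro sum_mono mult_left_mono member_le_sum) auto
    also have "\<dots> \<le> K * norm x * M"
      unfolding sum_distrib_right[symmetric]
      by (intro mult_right_mono u(2)) (simp add: M_def sum_nonneg)
    finally show ?thesis by (simp add: algebra_simps)
  qed
  then show ?thesis
    by (intro bounded_linear_intro add scale)
qed

text \<open>Only the first argument is expanded in a basis. Each partial map \<open>h b\<close> is
  bounded by the linear case, and the finitely many bounds add up to \<open>M\<close>.\<close>

lemma finite_dimensional_bounded_bilinear:
  fixes h :: "'a::real_normed_vector \<Rightarrow> 'b::real_normed_vector \<Rightarrow> 'c::real_normed_vector"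
  assumes "\<exists>S::'a set. finite S \<and> span S = UNIV" and "\<exists>S::'b set. finite S \<and> span S = UNIV"
    and "bilinear h"
  shows "bounded_bilinear h"
proof
  fix a a' b b' r
  show "h (a + a') b = h a b + h a' b" "h a (b + b') = h a b + h a b'"
    "h (r *\<^sub>R a) b = r *\<^sub>R h a b" "h a (r *\<^sub>R b) = r *\<^sub>R h a b"
    using assms(3) by (simp_all add: bilinear_ladd bilinear_radd bilinear_lmul bilinear_rmul)
next
  obtain S :: "'a set" and K where S: "finite S"
    "\<And>x. \<exists>u. x = (\<Sum>b\<in>S. u b *\<^sub>R b) \<and> (\<Sum>b\<in>S. \<bar>u b\<bar>) \<le> K * norm x"
    using finite_dimensional_coordinates[OF assms(1)] by blast
  have "bounded_linear (h a)" for a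
    using assms by (intro finite_dimensional_bounded_linear) (auto simp: bilinear_def)
  then have "\<exists>N>0. \<forall>y. norm (h a y) \<le> norm y * N" for a
    by (rule bounded_linear.pos_bounded)
  then obtain N where N: "\<And>a. N a > 0" "\<And>a y. norm (h a y) \<le> norm y * N a"
    by metis
  define M where "M = (\<Sum>b\<in>S. N b)"
  have "norm (h x y) \<le> norm x * norm y * (K * M)" for x y
  proof -
    interpret linear "\<lambda>x. h x y" using assms(3) by (simp add: bilinear_def)
    obtain u where u: "x = (\<Sum>b\<in>S. u b *\<^sub>R b)" "(\<Sum>b\<in>S. \<bar>u b\<bar>) \<le> K * norm x"
      using S(2) by blast
    have "norm (h x y) \<le> (\<Sum>b\<in>S. \<bar>u b\<bar> * norm (h b y))"
      unfolding u(1) sum scale by (rule sum_norm_le) simp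
    also have "\<dots> \<le> (\<Sum>b\<in>S. \<bar>u b\<bar> * (norm y * M))"
    proof (intro sum_mono mult_left_mono)
      fix b assume "b \<in> S"
      then have "N b \<le> M"
        unfolding M_def using S(1) N(1) by (intro member_le_sum) (auto intro: less_imp_le)
      then show "norm (h b y) \<le> norm y * M"
        using N(2)[of b y] by (meson mult_left_mono norm_ge_zero order_trans)
    qed simp
    also have "\<dots> \<le> K * norm x * (norm y * M)"
      unfolding sum_distrib_right[symmetric]
      by (intro mult_right_mono u(2)) (simp add: M_def sum_nonneg N(1) less_imp_le)
    finally show ?thesis by (simp add: algebra_simps)
  qed
  then show "\<exists>K. \<forall>x y. norm (h x y) \<le> norm x * norm y * K"
    by blast
qed

section \<open>Symmetry of second derivatives\<close>

text \<open>The mean value inequality on an interval, in the form applied twice below.\<close>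

lemma increment_bound:
  fixes g :: "real \<Rightarrow> 'a::real_normed_vector"
  assumes "0 \<le> s" "\<And>t. t \<in> {0..s} \<Longrightarrow> (g has_vector_derivative g' t) (at t within {0..s})"
    and "\<And>t. t \<in> {0..s} \<Longrightarrow> norm (g' t) \<le> b"
  shows "norm (g s - g 0) \<le> b * s"
proof -
  have "norm (g s - g 0) \<le> b * norm (s - 0)"
  proof (rule differentiable_bound)
    show "(g has_derivative (\<lambda>h. h *\<^sub>R g' t)) (at t within {0..s})" if "t \<in> {0..s}" for t
      using assms(2)[OF that] by (simp add: has_vector_derivative_def)
    show "onorm (\<lambda>h. h *\<^sub>R g' t) \<le> b" if "t \<in> {0..s}" for t
      using assms(3)[OF that] by (intro onorm_le) (simp add: mult.commute[of b] mult_left_mono)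
  qed (use assms(1) in auto)
  then show ?thesis using assms(1) by simp
qed

lemma directional_has_vector_derivative:
  assumes "f differentiable (at (p + t *\<^sub>R v))"
  shows "((\<lambda>t. f (p + t *\<^sub>R v)) has_vector_derivative frechet_derivative f (at (p + t *\<^sub>R v)) v)
    (at t within T)"
proof -
  let ?F = "frechet_derivative f (at (p + t *\<^sub>R v))"
  have F: "(f has_derivative ?F) (at (p + t *\<^sub>R v))"
    using assms frechet_derivative_works by blast
  have "((\<lambda>t. p + t *\<^sub>R v) has_derivative (\<lambda>h. h *\<^sub>R v)) (at t within T)"
    by (auto intro!: derivative_eq_intros)
  then have "((\<lambda>t. f (p + t *\<^sub>R v)) has_derivative (\<lambda>h. ?F (h *\<^sub>R v))) (at t within T)"
    using has_derivative_compose F by blast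
  then show ?thesis
    by (simp add: has_vector_derivative_def linear_scale[OF linear_frechet_derivative[OF assms]])
qed

text \<open>The mean value inequality is applied along \<open>w\<close> to the first derivative in
  direction \<open>u\<close>, then along \<open>u\<close> to \<open>f\<close>. Both times the
  expected linear term is subtracted first, so that only the oscillation of \<open>DD u w\<close>
  near \<open>x\<close> remains.\<close>

lemma second_difference_estimate:
  fixes f :: "'a::real_normed_vector \<Rightarrow> 'b::real_normed_vector"
  defines "D \<equiv> \<lambda>v y. frechet_derivative f (at y) v"
  defines "DD \<equiv> \<lambda>v w y. frechet_derivative (D v) (at y) w"
  assumes "open S" "x \<in> S" and f: "\<And>y. y \<in> S \<Longrightarrow> f differentiable (at y)"
    and Df: "\<And>y. y \<in> S \<Longrightarrow> D u differentiable (at y)"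
    and cont: "continuous_on S (DD u w)" and "e > 0"
  shows "\<exists>\<delta>>0. \<forall>s. 0 < s \<longrightarrow> s < \<delta> \<longrightarrow>
    norm (f (x + s *\<^sub>R u + s *\<^sub>R w) - f (x + s *\<^sub>R u) - f (x + s *\<^sub>R w) + f x - (s * s) *\<^sub>R DD u w x)
      \<le> e * s * s"
proof -
  obtain r where r: "r > 0" "ball x r \<subseteq> S"
    using \<open>open S\<close> \<open>x \<in> S\<close> openE by blast
  have "isCont (DD u w) x"
    using cont \<open>open S\<close> \<open>x \<in> S\<close> continuous_on_eq_continuous_at by blast
  then obtain r' where r': "r' > 0" "\<And>y. dist y x < r' \<Longrightarrow> dist (DD u w y) (DD u w x) < e"
    unfolding continuous_at_eps_delta using \<open>e > 0\<close> by blast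
  \<comment> \<open>For \<open>s < \<delta>\<close> the whole parallelogram spanned by
    \<open>s *\<^sub>R u\<close> and \<open>s *\<^sub>R w\<close> at \<open>x\<close> stays in both
    balls; the 1 keeps the denominator positive.\<close>
  define \<delta> where "\<delta> = min r r' / (norm u + norm w + 1)"
  have pos: "norm u + norm w + 1 > 0"
    by (smt (verit) norm_ge_zero)
  have "norm (f (x + s *\<^sub>R u + s *\<^sub>R w) - f (x + s *\<^sub>R u) - f (x + s *\<^sub>R w) + f x - (s * s) *\<^sub>R DD u w x)
      \<le> e * s * s" if s: "0 < s" "s < \<delta>" for s
  proof -
    have near: "dist (x + \<tau> *\<^sub>R u + \<sigma> *\<^sub>R w) x < min r r'"
      if "\<tau> \<in> {0..s}" "\<sigma> \<in> {0..s}" for \<tau> \<sigma>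
    proof -
      have "dist (x + \<tau> *\<^sub>R u + \<sigma> *\<^sub>R w) x = norm (\<tau> *\<^sub>R u + \<sigma> *\<^sub>R w)"
        by (simp add: dist_norm)
      also have "\<dots> \<le> \<tau> * norm u + \<sigma> * norm w"
        using that by (intro order_trans[OF norm_triangle_ineq]) simp
      also have "\<dots> \<le> s * (norm u + norm w + 1)"
        using that s by (simp add: distrib_left add_mono mult_right_mono add_increasing2)
      also have "\<dots> < min r r'"
        using s(2) pos by (simp add: \<delta>_def pos_less_divide_eq)
      finally show ?thesis .
    qed
    then have inS: "x + \<tau> *\<^sub>R u + \<sigma> *\<^sub>R w \<in> S" if "\<tau> \<in> {0..s}" "\<sigma> \<in> {0..s}" for \<tau> \<sigma>
      using that r(2) by (auto simp: dist_commute subset_iff)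
    have inner: "norm (D u (x + \<tau> *\<^sub>R u + s *\<^sub>R w) - D u (x + \<tau> *\<^sub>R u) - s *\<^sub>R DD u w x) \<le> e * s"
      if \<tau>: "\<tau> \<in> {0..s}" for \<tau>
    proof -
      let ?g = "\<lambda>\<sigma>. D u (x + \<tau> *\<^sub>R u + \<sigma> *\<^sub>R w) - \<sigma> *\<^sub>R DD u w x"
      have "norm (?g s - ?g 0) \<le> e * s"
      proof (rule increment_bound)
        fix \<sigma> assume \<sigma>: "\<sigma> \<in> {0..s}"
        show "(?g has_vector_derivative DD u w (x + \<tau> *\<^sub>R u + \<sigma> *\<^sub>R w) - DD u w x) (at \<sigma> within {0..s})"
          unfolding DD_def
          by (intro has_vector_derivative_diff directional_has_vector_derivative Df inS \<tau> \<sigma>)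
            (auto intro!: derivative_eq_intros simp: has_vector_derivative_def)
        show "norm (DD u w (x + \<tau> *\<^sub>R u + \<sigma> *\<^sub>R w) - DD u w x) \<le> e"
          using r'(2) near[OF \<tau> \<sigma>] by (simp add: dist_norm less_imp_le)
      qed (use s in simp)
      then show ?thesis by (simp add: algebra_simps)
    qed
    let ?h = "\<lambda>\<tau>. f (x + s *\<^sub>R w + \<tau> *\<^sub>R u) - f (x + \<tau> *\<^sub>R u) - \<tau> *\<^sub>R s *\<^sub>R DD u w x"
    have "norm (?h s - ?h 0) \<le> e * s * s"
    proof (rule increment_bound)
      fix \<tau> assume \<tau>: "\<tau> \<in> {0..s}"
      have "x + s *\<^sub>R w + \<tau> *\<^sub>R u \<in> S" "x + \<tau> *\<^sub>R u \<in> S"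
        using inS[OF \<tau>, of s] inS[OF \<tau>, of 0] s by (simp_all add: algebra_simps)
      then show "(?h has_vector_derivative
          D u (x + s *\<^sub>R w + \<tau> *\<^sub>R u) - D u (x + \<tau> *\<^sub>R u) - s *\<^sub>R DD u w x) (at \<tau> within {0..s})"
        unfolding D_def
        by (intro has_vector_derivative_diff directional_has_vector_derivative f)
          (auto intro!: derivative_eq_intros simp: has_vector_derivative_def)
      show "norm (D u (x + s *\<^sub>R w + \<tau> *\<^sub>R u) - D u (x + \<tau> *\<^sub>R u) - s *\<^sub>R DD u w x) \<le> e * s"
        using inner[OF \<tau>] by (simp add: algebra_simps)
    qed (use s in simp)
    then show ?thesis by (simp add: algebra_simps)
  qed
  moreover have "\<delta> > 0"
    using r(1) r'(1) pos by (simp add: \<delta>_def)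
  ultimately show ?thesis by blast
qed

text \<open>The second difference is symmetric in \<open>u\<close> and \<open>w\<close>, and divided
  by \<open>s * s\<close> it approximates both mixed derivatives. They therefore differ by at most
  any positive \<open>e\<close>.\<close>

lemma symmetric_second_derivative:
  fixes f :: "'a::real_normed_vector \<Rightarrow> 'b::real_normed_vector"
  assumes S: "open S" "x \<in> S" and f: "Ck_on 2 S f"
  shows "frechet_derivative (\<lambda>y. frechet_derivative f (at y) u) (at x) w =
    frechet_derivative (\<lambda>y. frechet_derivative f (at y) w) (at x) u"
proof -
  define DD where "DD v w y = frechet_derivative (\<lambda>y. frechet_derivative f (at y) v) (at y) w" for v w y
  have f': "Ck_on (Suc (Suc 0)) S f"
    using f by (simp add: numeral_2_eq_2)
  have est: "\<exists>\<delta>>0. \<forall>s. 0 < s \<longrightarrow> s < \<delta> \<longrightarrow>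
    norm (f (x + s *\<^sub>R u + s *\<^sub>R w) - f (x + s *\<^sub>R u) - f (x + s *\<^sub>R w) + f x - (s * s) *\<^sub>R DD u w x)
      \<le> e * s * s" if "e > 0" for u w e
    unfolding DD_def
    by (rule second_difference_estimate[OF S]) (use f' that in \<open>simp_all add: DD_def\<close>)
  \<comment> \<open>The summand 0 matches the shape of \<open>field_le_epsilon\<close>.\<close>
  have "norm (DD u w x - DD w u x) \<le> 0 + e" if "e > 0" for e
  proof -
    have "e / 2 > 0" using that by simp
    obtain \<delta>1 where \<delta>1: "\<delta>1 > 0" "\<And>s. 0 < s \<Longrightarrow> s < \<delta>1 \<Longrightarrow>
      norm (f (x + s *\<^sub>R u + s *\<^sub>R w) - f (x + s *\<^sub>R u) - f (x + s *\<^sub>R w) + f x - (s * s) *\<^sub>R DD u w x)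
        \<le> e / 2 * s * s"
      using est[OF \<open>e / 2 > 0\<close>, of u w] by blast
    obtain \<delta>2 where \<delta>2: "\<delta>2 > 0" "\<And>s. 0 < s \<Longrightarrow> s < \<delta>2 \<Longrightarrow>
      norm (f (x + s *\<^sub>R w + s *\<^sub>R u) - f (x + s *\<^sub>R w) - f (x + s *\<^sub>R u) + f x - (s * s) *\<^sub>R DD w u x)
        \<le> e / 2 * s * s"
      using est[OF \<open>e / 2 > 0\<close>, of w u] by blast
    define s where "s = min \<delta>1 \<delta>2 / 2"
    have s: "0 < s" "s < \<delta>1" "s < \<delta>2"
      using \<delta>1(1) \<delta>2(1) by (auto simp: s_def min_def)
    define P where "P = f (x + s *\<^sub>R u + s *\<^sub>R w) - f (x + s *\<^sub>R u) - f (x + s *\<^sub>R w) + f x"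
    have P2: "P = f (x + s *\<^sub>R w + s *\<^sub>R u) - f (x + s *\<^sub>R w) - f (x + s *\<^sub>R u) + f x"
      by (simp add: P_def algebra_simps)
    have "norm ((s * s) *\<^sub>R (DD u w x - DD w u x)) =
      norm ((P - (s * s) *\<^sub>R DD w u x) - (P - (s * s) *\<^sub>R DD u w x))"
      by (simp add: scaleR_diff_right)
    also have "\<dots> \<le> e / 2 * s * s + e / 2 * s * s"
      using \<delta>1(2)[OF s(1,2)] \<delta>2(2)[OF s(1,3)] unfolding P_def[symmetric] P2[symmetric]
      using norm_triangle_ineq4[of "P - (s * s) *\<^sub>R DD w u x" "P - (s * s) *\<^sub>R DD u w x"] by linarith
    finally have "(s * s) * norm (DD u w x - DD w u x) \<le> (s * s) * e"
      by (simp add: mult.commute mult.left_commute)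
    then show ?thesis
      using s(1) by (simp only: mult_le_cancel_left_pos mult_pos_pos add_0)
  qed
  then have "norm (DD u w x - DD w u x) \<le> 0"
    by (rule field_le_epsilon)
  then show ?thesis by (simp add: DD_def)
qed

section \<open>Alternation\<close>

definition alternate ::
  "nat \<Rightarrow> ((nat \<Rightarrow> 'e) \<Rightarrow> 'w::real_vector) \<Rightarrow> (nat \<Rightarrow> 'e) \<Rightarrow> 'w"
  where "alternate n T v = (\<Sum>\<sigma> | \<sigma> permutes {..<n}. of_int (sign \<sigma>) *\<^sub>R T (\<lambda>i. v (\<sigma> i)))"

text \<open>Composed with an argument sequence \<open>v\<close>, this cycle yields
  \<open>v k, v 0, ..., v (k - 1), v (k + 1), ...\<close>: argument \<open>k\<close> moves to the
  front and the others keep their order.\<close>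

definition cycle_to_front :: "nat \<Rightarrow> nat \<Rightarrow> nat"
  where "cycle_to_front k i = (case i of 0 \<Rightarrow> k | Suc j \<Rightarrow> if j < k then j else Suc j)"

text \<open>The embedding of permutations as acting on the block of indices that starts at
  \<open>p\<close>.\<close>

definition shift_perm :: "nat \<Rightarrow> (nat \<Rightarrow> nat) \<Rightarrow> nat \<Rightarrow> nat"
  where "shift_perm p \<tau> i = (if i < p then i else p + \<tau> (i - p))"

section \<open>Signs of cycles and of shifted permutations\<close>

lemma cycle_to_front_0 [simp]: "cycle_to_front k 0 = k"
  and cycle_to_front_Suc: "cycle_to_front k (Suc j) = (if j < k then j else Suc j)"
  by (simp_all add: cycle_to_front_def)

lemma omit_eq_cycle_to_front: "omit k v = (\<lambda>j. v (cycle_to_front k (Suc j)))"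
  by (auto simp: omit_def cycle_to_front_Suc)

lemma cycle_to_front_step: "cycle_to_front (Suc k) = Transposition.transpose k (Suc k) \<circ> cycle_to_front k"
  by (rule ext) (auto simp: cycle_to_front_def Transposition.transpose_def split: nat.split)

lemma permutation_lessThan: "\<sigma> permutes {..<n::nat} \<Longrightarrow> permutation \<sigma>"
  using permutes_imp_permutation by blast

lemma sign_transpose_comp:
  "permutation \<sigma> \<Longrightarrow> a \<noteq> b \<Longrightarrow> sign (Transposition.transpose a b \<circ> \<sigma>) = - sign \<sigma>"
  "permutation \<sigma> \<Longrightarrow> a \<noteq> b \<Longrightarrow> sign (\<sigma> \<circ> Transposition.transpose a b) = - sign \<sigma>"
  by (subst sign_compose; simp add: permutation_swap_id sign_swap_id)+

text \<open>The cycle is a product of \<open>k\<close> adjacent transpositions.\<close>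

lemma cycle_to_front_permutes_sign:
  "k < n \<Longrightarrow> cycle_to_front k permutes {..<n} \<and> sign (cycle_to_front k) = (- 1) ^ k"
proof (induction k)
  case 0
  have "cycle_to_front 0 = id"
    by (rule ext) (simp add: cycle_to_front_def split: nat.split)
  then show ?case using permutes_id by (metis power_0 sign_id)
next
  case (Suc k)
  then have *: "cycle_to_front k permutes {..<n}" "sign (cycle_to_front k) = (- 1) ^ k"
    by auto
  have "Transposition.transpose k (Suc k) permutes {..<n}"
    using Suc.prems by (intro permutes_swap_id) auto
  then have "cycle_to_front (Suc k) permutes {..<n}"
    unfolding cycle_to_front_step by (rule permutes_compose[OF *(1)])
  moreover have "sign (cycle_to_front (Suc k)) = (- 1) ^ Suc k"
    unfolding cycle_to_front_step
    by (subst sign_transpose_comp(1)) (use * in \<open>simp_all add: permutation_lessThan\<close>)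
  ultimately show ?case ..
qed

lemmas cycle_to_front_permutes = cycle_to_front_permutes_sign[THEN conjunct1]
lemmas sign_cycle_to_front = cycle_to_front_permutes_sign[THEN conjunct2]

text \<open>Induction over transpositions: the shift carries the one of \<open>a\<close> and
  \<open>b\<close> to the one of \<open>p + a\<close> and \<open>p + b\<close>, so both signs change
  together.\<close>

lemma shift_perm_permutes_sign:
  assumes "\<tau> permutes {..<q}" "p + q \<le> n"
  shows "shift_perm p \<tau> permutes {..<n} \<and> sign (shift_perm p \<tau>) = sign \<tau>"
  using assms(1) finite_lessThan
proof (induction rule: permutes_induct)
  case id
  have "shift_perm p id = id"
    by (rule ext) (simp add: shift_perm_def)
  then show ?case using permutes_id by metis
next
  case (swap a b t)
  have eq: "shift_perm p (Transposition.transpose a b \<circ> t) = Transposition.transpose (p + a) (p + b) \<circ> shift_perm p t"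
    by (rule ext) (auto simp: shift_perm_def Transposition.transpose_def swap.hyps)
  have tr: "Transposition.transpose (p + a) (p + b) permutes {..<n}"
    using swap.hyps assms(2) by (intro permutes_swap_id) auto
  have "shift_perm p (Transposition.transpose a b \<circ> t) permutes {..<n}"
    unfolding eq by (rule permutes_compose[OF conjunct1[OF swap.IH] tr])
  moreover have "sign (shift_perm p (Transposition.transpose a b \<circ> t)) =
      sign (Transposition.transpose a b \<circ> t)"
    unfolding eq
    by (subst (1 2) sign_transpose_comp(1))
      (use swap.hyps swap.IH in
        \<open>simp_all add: permutation_lessThan permutation_lessThan[OF conjunct1[OF swap.IH]]\<close>)
  ultimately show ?case ..
qed

section \<open>Alternation under permutations and inner alternations\<close>

text \<open>Reindexing the sum by composition with \<open>\<tau>\<close> on the right produces the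
  factor \<open>sign \<tau>\<close>, which is its own inverse.\<close>

lemma alternate_permute:
  assumes "\<tau> permutes {..<n}"
  shows "alternate n (\<lambda>v. T (\<lambda>i. v (\<tau> i))) v = of_int (sign \<tau>) *\<^sub>R alternate n T v"
proof -
  have "of_int (sign \<tau>) *\<^sub>R alternate n T v =
      (\<Sum>\<sigma> | \<sigma> permutes {..<n}. of_int (sign \<tau> * sign \<sigma>) *\<^sub>R T (\<lambda>i. v (\<sigma> i)))"
    by (simp add: alternate_def scaleR_sum_right)
  also have "\<dots> = (\<Sum>\<sigma> | \<sigma> permutes {..<n}. of_int (sign \<tau> * sign (\<sigma> \<circ> \<tau>)) *\<^sub>R T (\<lambda>i. v ((\<sigma> \<circ> \<tau>) i)))"
    by (rule sum_permutations_compose_right[OF assms])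
  also have "\<dots> = alternate n (\<lambda>v. T (\<lambda>i. v (\<tau> i))) v"
    unfolding alternate_def
    by (intro sum.cong refl)
      (use assms in \<open>simp add: sign_compose permutation_lessThan mult.left_commute\<close>)
  finally show ?thesis by simp
qed

lemma alternate_cycle_to_front:
  assumes "k < n"
  shows "alternate n (\<lambda>v. T (\<lambda>i. v (cycle_to_front k i))) v = (- 1) ^ k *\<^sub>R alternate n T v"
  using alternate_permute[OF cycle_to_front_permutes[OF assms], of T]
  by (simp add: sign_cycle_to_front[OF assms])

lemma alternate_sum: "alternate n (\<lambda>v. \<Sum>a\<in>P. T a v) v = (\<Sum>a\<in>P. alternate n (T a) v)"
  unfolding alternate_def scaleR_sum_right by (rule sum.swap)

lemma alternate_scaleR: "alternate n (\<lambda>v. r *\<^sub>R T v) v = r *\<^sub>R alternate n T v"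
  by (simp add: alternate_def scaleR_sum_right mult.commute)

lemma alternate_add: "alternate n (\<lambda>v. S v + T v) v = alternate n S v + alternate n T v"
  by (simp add: alternate_def scaleR_add_right sum.distrib)

lemma alternate_diff: "alternate n (\<lambda>v. S v - T v) v = alternate n S v - alternate n T v"
  by (simp add: alternate_def scaleR_diff_right sum_subtractf)

text \<open>The sign in front of each summand cancels the sign produced by permuting its arguments,
  so every \<open>\<tau>\<close> contributes the same value. This is the common core of the two
  block lemmas.\<close>

lemma alternate_average:
  assumes "finite P" and "\<And>\<tau>. \<tau> \<in> P \<Longrightarrow> g \<tau> permutes {..<n}"
  shows "alternate n (\<lambda>v. \<Sum>\<tau>\<in>P. of_int (sign (g \<tau>)) *\<^sub>R T (\<lambda>i. v (g \<tau> i))) v =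
    of_nat (card P) *\<^sub>R alternate n T v"
proof -
  have "alternate n (\<lambda>v. of_int (sign (g \<tau>)) *\<^sub>R T (\<lambda>i. v (g \<tau> i))) v = alternate n T v"
    if "\<tau> \<in> P" for \<tau>
    by (simp add: alternate_scaleR alternate_permute[OF assms(2)[OF that], of T]
        flip: of_int_mult)
  then show ?thesis
    by (simp add: alternate_sum sum_constant_scaleR)
qed

text \<open>A permutation of the first \<open>p\<close> indices is also one of \<open>p + q\<close>
  indices, and it leaves the arguments of \<open>R\<close> alone. The inner alternation is thus a
  signed average over \<open>fact p\<close> permutations.\<close>

lemma alternate_left_block:
  assumes "bilinear m"
  shows "alternate (p + q) (\<lambda>v. m (alternate p S v) (R (\<lambda>i. v (p + i)))) v =
    fact p *\<^sub>R alternate (p + q) (\<lambda>v. m (S v) (R (\<lambda>i. v (p + i)))) v"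
proof -
  let ?P = "{\<tau>. \<tau> permutes {..<p}}"
  let ?T = "\<lambda>v. m (S v) (R (\<lambda>i. v (p + i)))"
  have "m (alternate p S v) (R (\<lambda>i. v (p + i))) =
      (\<Sum>\<tau>\<in>?P. of_int (sign \<tau>) *\<^sub>R ?T (\<lambda>i. v (\<tau> i)))" for v
  proof -
    interpret linear "\<lambda>x. m x (R (\<lambda>i. v (p + i)))"
      using assms by (simp add: bilinear_def)
    have tail: "\<tau> (p + i) = p + i" if "\<tau> \<in> ?P" for \<tau> i
      using that by (auto simp: permutes_def)
    show ?thesis
      unfolding alternate_def sum scale by (intro sum.cong refl) (simp only: tail)
  qed
  moreover have "\<tau> permutes {..<p + q}" if "\<tau> \<in> ?P" for \<tau>
    using that by (auto intro: permutes_subset)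
  ultimately show ?thesis
    using alternate_average[of ?P "\<lambda>\<tau>. \<tau>" "p + q" ?T v]
    by (simp add: finite_permutations card_permutations)
qed

text \<open>As for the left block, with the inner permutations shifted past \<open>p\<close>. The
  factor \<open>S\<close> is handed the entire sequence, so its dependence on the first
  \<open>p\<close> arguments alone is what protects it from these permutations.\<close>

lemma alternate_right_block:
  assumes "bilinear m" and S: "\<And>v v'. (\<And>i. i < p \<Longrightarrow> v i = v' i) \<Longrightarrow> S v = S v'"
  shows "alternate (p + q) (\<lambda>v. m (S v) (alternate q R (\<lambda>i. v (p + i)))) v =
    fact q *\<^sub>R alternate (p + q) (\<lambda>v. m (S v) (R (\<lambda>i. v (p + i)))) v"
proof -
  let ?P = "{\<tau>. \<tau> permutes {..<q}}"
  let ?T = "\<lambda>v. m (S v) (R (\<lambda>i. v (p + i)))"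
  have sh: "shift_perm p \<tau> permutes {..<p + q}" "sign (shift_perm p \<tau>) = sign \<tau>" if "\<tau> \<in> ?P" for \<tau>
    using shift_perm_permutes_sign[of \<tau> q p "p + q"] that by auto
  have "m (S v) (alternate q R (\<lambda>i. v (p + i))) =
      (\<Sum>\<tau>\<in>?P. of_int (sign (shift_perm p \<tau>)) *\<^sub>R ?T (\<lambda>i. v (shift_perm p \<tau> i)))" for v
  proof -
    interpret linear "m (S v)"
      using assms(1) by (simp add: bilinear_def)
    have "S (\<lambda>i. v (shift_perm p \<tau> i)) = S v" for \<tau>
      by (rule S) (simp add: shift_perm_def)
    moreover have "shift_perm p \<tau> (p + i) = p + \<tau> i" for \<tau> i
      by (simp add: shift_perm_def)
    ultimately show ?thesis
      unfolding alternate_def sum scale by (intro sum.cong refl) (simp add: sh)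
  qed
  then show ?thesis
    using alternate_average[of ?P "shift_perm p" "p + q" ?T v] sh(1)
    by (simp add: finite_permutations card_permutations)
qed

text \<open>The index \<open>i\<close> is the image of 0, and \<open>\<tau>\<close> describes the
  order of the remaining values. Surjectivity of this parametrisation follows from injectivity by
  counting.\<close>

lemma sum_permutes_lessThan_Suc:
  fixes f :: "(nat \<Rightarrow> nat) \<Rightarrow> 'a::comm_monoid_add"
  shows "(\<Sum>\<sigma> | \<sigma> permutes {..<Suc k}. f \<sigma>) =
    (\<Sum>i\<le>k. \<Sum>\<tau> | \<tau> permutes {..<k}. f (cycle_to_front i \<circ> shift_perm 1 \<tau>))"
proof -
  let ?P = "{\<tau>. \<tau> permutes {..<k}}" and ?Q = "{\<sigma>. \<sigma> permutes {..<Suc k}}"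
  let ?g = "\<lambda>(i, \<tau>). cycle_to_front i \<circ> shift_perm 1 \<tau>"
  have inj: "inj_on ?g ({..k} \<times> ?P)"
  proof (rule inj_onI, clarsimp)
    fix i i' \<tau> \<tau>'
    assume le: "i \<le> k" "i' \<le> k"
      and eq: "cycle_to_front i \<circ> shift_perm (Suc 0) \<tau> = cycle_to_front i' \<circ> shift_perm (Suc 0) \<tau>'"
    \<comment> \<open>A permutation shifted by 1 fixes 0, so evaluation at 0 reads off
      \<open>i\<close>.\<close>
    have ii': "i = i'"
      using fun_cong[OF eq, of 0] by (simp add: shift_perm_def)
    have "inj (cycle_to_front i)"
      using cycle_to_front_permutes[of i "Suc k"] le permutes_inj by auto
    then have "shift_perm (Suc 0) \<tau> j = shift_perm (Suc 0) \<tau>' j" for j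
      using fun_cong[OF eq, of j] ii' by (simp add: inj_eq)
    from this[of "Suc _"] have "\<tau> j = \<tau>' j" for j
      by (simp add: shift_perm_def)
    with ii' show "i = i' \<and> \<tau> = \<tau>'" by auto
  qed
  have sub: "?g ` ({..k} \<times> ?P) \<subseteq> ?Q"
    using shift_perm_permutes_sign[of _ k 1 "Suc k"] cycle_to_front_permutes[of _ "Suc k"]
    by (auto intro!: permutes_compose)
  have "card (?g ` ({..k} \<times> ?P)) = card ?Q"
    using card_image[OF inj] by (simp add: card_cartesian_product card_permutations)
  then have "?g ` ({..k} \<times> ?P) = ?Q"
    using sub by (intro card_subset_eq finite_permutations) auto
  then have "sum f ?Q = sum (f \<circ> ?g) ({..k} \<times> ?P)"
    using sum.reindex[OF inj, of f] by simp
  then show ?thesis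
    by (simp add: sum.cartesian_product case_prod_unfold)
qed

section \<open>Alternating forms under permutations of their arguments\<close>

text \<open>Polarisation: put \<open>s = v a + v b\<close> into both slots and expand. The terms
  with equal entries vanish, and the two mixed ones must cancel.\<close>

lemma alternating_form_swap:
  assumes "alternating_form k \<eta>" "a < k" "b < k" "a \<noteq> b"
  shows "\<eta> (\<lambda>i. v (Transposition.transpose a b i)) = - \<eta> v"
proof -
  have lin: "linear (\<lambda>u. \<eta> (v(i := u)))" if "i < k" for v i
    using assms(1) that by (simp add: alternating_form_def)
  have zero: "\<eta> v = 0" if "v a = v b" for v
    using assms that by (auto simp: alternating_form_def)
  define s where "s = v a + v b"
  have add: "\<eta> (w(i := x + y)) = \<eta> (w(i := x)) + \<eta> (w(i := y))" if "i < k" for w i x y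
    using linear_add[OF lin[OF that]] by simp
  have "\<eta> (v(a := s, b := s)) = \<eta> (v(a := s, b := v a)) + \<eta> (v(a := s, b := v b))"
    using add[OF assms(3), of "v(a := s)" "v a" "v b"] by (simp add: s_def)
  moreover have "v(a := s, b := v a) = v(b := v a, a := s)" "v(a := s, b := v b) = v(a := s)"
    using assms(4) by (auto simp: fun_upd_twist)
  moreover have "\<eta> (v(b := v a, a := s)) = \<eta> (v(b := v a, a := v a)) + \<eta> (v(b := v a, a := v b))"
    using add[OF assms(2), of "v(b := v a)" "v a" "v b"] by (simp add: s_def)
  moreover have "\<eta> (v(a := s)) = \<eta> v + \<eta> (v(a := v b))"
    using add[OF assms(2), of v "v a" "v b"] by (simp add: s_def)
  moreover have "\<eta> (v(a := s, b := s)) = 0" "\<eta> (v(b := v a, a := v a)) = 0" "\<eta> (v(a := v b)) = 0"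
    using assms(4) by (auto intro!: zero)
  moreover have "v(b := v a, a := v b) = (\<lambda>i. v (Transposition.transpose a b i))"
    by (auto simp: Transposition.transpose_def)
  ultimately show ?thesis
    by (simp add: eq_neg_iff_add_eq_0 add.commute)
qed

text \<open>Transpositions are split off on the right, because
  \<open>v \<circ> p \<circ> transpose a b\<close> is the sequence \<open>v \<circ> p\<close> with
  two slots exchanged.\<close>

lemma alternating_form_permute:
  assumes "alternating_form k \<eta>" "\<sigma> permutes {..<k}"
  shows "\<eta> (\<lambda>i. v (\<sigma> i)) = of_int (sign \<sigma>) *\<^sub>R \<eta> v"
  using finite_lessThan assms(2)
proof (induction arbitrary: v rule: permutes_rev_induct)
  case id
  then show ?case by simp
next
  case (swap a b p)
  have "\<eta> (\<lambda>i. v ((p \<circ> Transposition.transpose a b) i)) = - \<eta> (\<lambda>i. v (p i))"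
    using alternating_form_swap[OF assms(1), of a b "\<lambda>i. v (p i)"] swap.hyps by simp
  moreover have "sign (p \<circ> Transposition.transpose a b) = - sign p"
    using swap.hyps by (intro sign_transpose_comp(2) permutation_lessThan)
  ultimately show ?case
    by (simp only: swap.IH of_int_minus scaleR_minus_left)
qed

lemma alternating_form_cong:
  assumes "alternating_form k \<eta>" "\<And>i. i < k \<Longrightarrow> v i = v' i"
  shows "\<eta> v = \<eta> v'"
  using assms unfolding alternating_form_def by blast

lemma alternate_alternating_form:
  assumes "alternating_form k \<eta>"
  shows "alternate k \<eta> v = fact k *\<^sub>R \<eta> v"
proof -
  have "alternate k \<eta> v = (\<Sum>\<sigma> | \<sigma> permutes {..<k}. \<eta> v)"
    unfolding alternate_def
    by (intro sum.cong refl) (simp add: alternating_form_permute[OF assms] flip: of_int_mult)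
  then show ?thesis
    by (simp add: sum_constant_scaleR card_permutations)
qed

section \<open>Exterior derivatives and wedge products\<close>

text \<open>The derivative before alternation: slot 0 holds the direction of differentiation, and
  the arguments of the form move up by one.\<close>

definition gradient ::
  "('m, 'e::real_normed_vector, 'w::real_normed_vector) form \<Rightarrow> ('m, 'e, 'w) form"
  where "gradient \<omega> = (\<lambda>c x v. frechet_derivative (\<lambda>y. \<omega> c y (\<lambda>i. v (Suc i))) (at x) (v 0))"

definition form_differentiable ::
  "('m, 'e::real_normed_vector, 'w::real_normed_vector) form \<Rightarrow> ('m, 'e) chart \<Rightarrow> 'e \<Rightarrow> bool"
  where "form_differentiable \<omega> c x \<longleftrightarrow> (\<forall>v. (\<lambda>y. \<omega> c y v) differentiable (at x))"

lemma form_differentiableD: "form_differentiable \<omega> c x \<Longrightarrow> (\<lambda>y. \<omega> c y v) differentiable (at x)"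
  by (simp add: form_differentiable_def)

section \<open>Derivatives of linear and bilinear expressions\<close>

lemma frechet_derivative_linear_combination:
  assumes "finite P" "\<And>a. a \<in> P \<Longrightarrow> f a differentiable (at x)"
  shows "frechet_derivative (\<lambda>y. \<Sum>a\<in>P. r a *\<^sub>R f a y) (at x) u =
    (\<Sum>a\<in>P. r a *\<^sub>R frechet_derivative (f a) (at x) u)"
proof -
  have "((\<lambda>y. \<Sum>a\<in>P. r a *\<^sub>R f a y) has_derivative
      (\<lambda>u. \<Sum>a\<in>P. r a *\<^sub>R frechet_derivative (f a) (at x) u)) (at x)"
    using assms(2)
    by (intro has_derivative_sum has_derivative_scaleR_right) (simp flip: frechet_derivative_works)
  from fun_cong[OF frechet_derivative_at[OF this], of u] show ?thesis
    by (rule sym)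
qed

lemma frechet_derivative_bilinear:
  assumes "bounded_bilinear m" "f differentiable (at x)" "g differentiable (at x)"
  shows "frechet_derivative (\<lambda>y. m (f y) (g y)) (at x) u =
    m (f x) (frechet_derivative g (at x) u) + m (frechet_derivative f (at x) u) (g x)"
proof -
  have "((\<lambda>y. m (f y) (g y)) has_derivative (\<lambda>u. m (f x) (frechet_derivative g (at x) u) +
      m (frechet_derivative f (at x) u) (g x))) (at x)"
    using assms(2,3)
    by (intro bounded_bilinear.FDERIV[OF assms(1)]) (simp_all flip: frechet_derivative_works)
  from fun_cong[OF frechet_derivative_at[OF this], of u] show ?thesis
    by (rule sym)
qed

lemma differentiable_bilinear:
  assumes "bounded_bilinear m" "f differentiable (at x)" "g differentiable (at x)"
  shows "(\<lambda>y. m (f y) (g y)) differentiable (at x)"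
  using bounded_bilinear.FDERIV[OF assms(1) assms(2,3)[unfolded frechet_derivative_works]]
  by (rule differentiableI)

lemma bounded_bilinear_imp_bilinear:
  assumes "bounded_bilinear m"
  shows "bilinear m"
  using bounded_bilinear.bounded_linear_left[OF assms] bounded_bilinear.bounded_linear_right[OF assms]
  by (simp add: bilinear_def bounded_linear.linear)

lemma frechet_derivative_linear:
  assumes "bounded_linear f" "g differentiable (at x)"
  shows "frechet_derivative (\<lambda>y. f (g y)) (at x) u = f (frechet_derivative g (at x) u)"
proof -
  have "((\<lambda>y. f (g y)) has_derivative (\<lambda>u. f (frechet_derivative g (at x) u))) (at x)"
    by (rule bounded_linear.has_derivative[OF assms(1) assms(2)[unfolded frechet_derivative_works]])
  from fun_cong[OF frechet_derivative_at[OF this], of u] show ?thesis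
    by (rule sym)
qed

lemma differentiable_linear:
  assumes "bounded_linear f" "g differentiable (at x)"
  shows "(\<lambda>y. f (g y)) differentiable (at x)"
  using bounded_linear.has_derivative[OF assms(1) assms(2)[unfolded frechet_derivative_works]]
  by (rule differentiableI)

lemma wedge_eq_alternate:
  "wedge m p q \<omega> \<eta> c x v =
    (1 / (fact p * fact q)) *\<^sub>R alternate (p + q) (\<lambda>v. m (\<omega> c x v) (\<eta> c x (\<lambda>i. v (p + i)))) v"
  by (simp add: wedge_def alternate_def)

section \<open>The exterior derivative as an alternated gradient\<close>

text \<open>Summand \<open>i\<close> of the exterior derivative together with an inner permutation
  \<open>\<tau>\<close> is exactly the permutation
  \<open>cycle_to_front i \<circ> shift_perm 1 \<tau>\<close>: it puts \<open>v i\<close> into the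
  direction slot and permutes \<open>omit i v\<close> by \<open>\<tau>\<close>. The signs agree as
  well.\<close>

lemma ext_deriv_alternate:
  assumes "form_differentiable \<omega> c x"
  shows "ext_deriv k (\<lambda>c x. alternate k (\<omega> c x)) c x v = alternate (Suc k) (gradient \<omega> c x) v"
proof -
  have sgn: "real_of_int (sign (cycle_to_front i \<circ> shift_perm 1 \<tau>)) = (- 1) ^ i * of_int (sign \<tau>)"
    if "i \<le> k" "\<tau> permutes {..<k}" for i \<tau>
  proof -
    have "shift_perm 1 \<tau> permutes {..<Suc k}" "sign (shift_perm 1 \<tau>) = sign \<tau>"
      using shift_perm_permutes_sign[OF that(2), of 1 "Suc k"] by auto
    moreover have "cycle_to_front i permutes {..<Suc k}" "sign (cycle_to_front i) = (- 1) ^ i"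
      using that(1) by (simp_all add: cycle_to_front_permutes sign_cycle_to_front[of i "Suc k"])
    ultimately show ?thesis
      by (simp add: sign_compose permutation_lessThan[of _ "Suc k"])
  qed
  have "ext_deriv k (\<lambda>c x. alternate k (\<omega> c x)) c x v =
    (\<Sum>i\<le>k. \<Sum>\<tau> | \<tau> permutes {..<k}. ((- 1) ^ i * of_int (sign \<tau>)) *\<^sub>R
      frechet_derivative (\<lambda>y. \<omega> c y (\<lambda>j. omit i v (\<tau> j))) (at x) (v i))"
    unfolding ext_deriv_def alternate_def
    by (subst frechet_derivative_linear_combination)
      (simp_all add: finite_permutations form_differentiableD[OF assms] scaleR_sum_right)
  also have "\<dots> = alternate (Suc k) (gradient \<omega> c x) v"
    unfolding alternate_def sum_permutes_lessThan_Suc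
    by (intro sum.cong refl, subst sgn)
      (auto simp: gradient_def shift_perm_def omit_eq_cycle_to_front)
  finally show ?thesis .
qed

lemma ext_deriv_cong:
  assumes "open U" "x \<in> U" "\<And>y. y \<in> U \<Longrightarrow> \<omega> c y = \<eta> c y" "form_differentiable \<omega> c x"
  shows "ext_deriv k \<omega> c x v = ext_deriv k \<eta> c x v"
proof -
  have "frechet_derivative (\<lambda>y. \<omega> c y w) (at x) = frechet_derivative (\<lambda>y. \<eta> c y w) (at x)" for w
    using form_differentiableD[OF assms(4)] assms(1,2)
    by (rule frechet_derivative_transform_within_open) (simp add: assms(3))
  then show ?thesis by (simp add: ext_deriv_def)
qed

text \<open>An alternating form is the alternation of \<open>1 / fact k\<close> times itself. As
  this holds on a neighbourhood of \<open>x\<close>, it may be differentiated.\<close>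

lemma ext_deriv_eq_alternate:
  assumes "open U" "x \<in> U" "\<And>y. y \<in> U \<Longrightarrow> alternating_form k (\<omega> c y)" "form_differentiable \<omega> c x"
  shows "ext_deriv k \<omega> c x v = (1 / fact k) *\<^sub>R alternate (Suc k) (gradient \<omega> c x) v"
proof -
  let ?\<eta> = "\<lambda>c x v. (1 / fact k) *\<^sub>R \<omega> c x v"
  have diff: "form_differentiable ?\<eta> c x"
    using assms(4) by (auto simp: form_differentiable_def)
  have "ext_deriv k \<omega> c x v = ext_deriv k (\<lambda>c x. alternate k (?\<eta> c x)) c x v"
    by (rule ext_deriv_cong[OF assms(1,2)])
      (auto simp: alternate_scaleR alternate_alternating_form assms fun_eq_iff)
  also have "\<dots> = alternate (Suc k) (gradient ?\<eta> c x) v"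
    by (rule ext_deriv_alternate[OF diff])
  also have "gradient ?\<eta> c x = (\<lambda>v. (1 / fact k) *\<^sub>R gradient \<omega> c x v)"
    unfolding gradient_def
    by (intro ext frechet_derivative_linear bounded_linear_scaleR_right
        form_differentiableD[OF assms(4)])
  finally show ?thesis by (simp add: alternate_scaleR)
qed

lemma ext_deriv_add:
  assumes "form_differentiable \<omega> c x" "form_differentiable \<eta> c x"
  shows "ext_deriv k (\<omega> + \<eta>) c x v = ext_deriv k \<omega> c x v + ext_deriv k \<eta> c x v"
proof -
  have "frechet_derivative (\<lambda>y. \<omega> c y w + \<eta> c y w) (at x) u =
    frechet_derivative (\<lambda>y. \<omega> c y w) (at x) u + frechet_derivative (\<lambda>y. \<eta> c y w) (at x) u" for w u
    by (rule fun_cong[OF frechet_derivative_at[OF has_derivative_add], symmetric])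
      (simp_all add: form_differentiableD assms flip: frechet_derivative_works)
  then show ?thesis
    by (simp add: ext_deriv_def scaleR_add_right sum.distrib)
qed

lemma ext_deriv_diff:
  assumes "form_differentiable \<omega> c x" "form_differentiable \<eta> c x"
  shows "ext_deriv k (\<omega> - \<eta>) c x v = ext_deriv k \<omega> c x v - ext_deriv k \<eta> c x v"
proof -
  have "frechet_derivative (\<lambda>y. \<omega> c y w - \<eta> c y w) (at x) u =
    frechet_derivative (\<lambda>y. \<omega> c y w) (at x) u - frechet_derivative (\<lambda>y. \<eta> c y w) (at x) u" for w u
    by (rule fun_cong[OF frechet_derivative_at[OF has_derivative_diff], symmetric])
      (simp_all add: form_differentiableD assms flip: frechet_derivative_works)
  then show ?thesis
    by (simp add: ext_deriv_def scaleR_diff_right sum_subtractf)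
qed

lemma ext_deriv_form_map:
  assumes "bounded_linear f" "form_differentiable \<omega> c x"
  shows "ext_deriv k (form_map f \<omega>) c x v = f (ext_deriv k \<omega> c x v)"
proof -
  interpret bounded_linear f by fact
  show ?thesis
    by (simp add: ext_deriv_def form_map_def sum scale
        frechet_derivative_linear[OF assms(1) form_differentiableD[OF assms(2)]])
qed

text \<open>Supplies for an exterior derivative the dependence on finitely many arguments that
  \<open>wedge_swap_one_form\<close> asks for.\<close>

lemma ext_deriv_depends:
  assumes "open U" "x \<in> U" "\<And>y. y \<in> U \<Longrightarrow> alternating_form k (\<omega> c y)" "form_differentiable \<omega> c x"
    and "\<And>i. i < Suc k \<Longrightarrow> v i = v' i"
  shows "ext_deriv k \<omega> c x v = ext_deriv k \<omega> c x v'"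
  unfolding ext_deriv_def
proof (intro sum.cong refl arg_cong[where f = "scaleR _"])
  fix i assume i: "i \<in> {..k}"
  have "\<omega> c y (omit i v) = \<omega> c y (omit i v')" if "y \<in> U" for y
    using assms(3)[OF that] by (rule alternating_form_cong) (use i assms(5) in \<open>auto simp: omit_def\<close>)
  then have "frechet_derivative (\<lambda>y. \<omega> c y (omit i v)) (at x) =
      frechet_derivative (\<lambda>y. \<omega> c y (omit i v')) (at x)"
    using assms by (intro frechet_derivative_transform_within_open[of _ x U] form_differentiableD)
  then show "frechet_derivative (\<lambda>y. \<omega> c y (omit i v)) (at x) (v i) =
      frechet_derivative (\<lambda>y. \<omega> c y (omit i v')) (at x) (v' i)"
    using i assms(5) by simp
qed

section \<open>The Leibniz rule\<close>

lemma form_differentiable_wedge: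
  assumes "bounded_bilinear m" "form_differentiable \<omega> c x" "form_differentiable \<eta> c x"
  shows "form_differentiable (wedge m p q \<omega> \<eta>) c x"
proof -
  note scale = differentiable_linear[OF bounded_linear_scaleR_right]
  have "(\<lambda>y. m (\<omega> c y u) (\<eta> c y w)) differentiable (at x)" for u w
    by (rule differentiable_bilinear[OF assms(1) form_differentiableD[OF assms(2)]
          form_differentiableD[OF assms(3)]])
  then have "(\<lambda>y. \<Sum>\<sigma> | \<sigma> permutes {..<p + q}. of_int (sign \<sigma>) *\<^sub>R
      m (\<omega> c y (\<lambda>i. v (\<sigma> i))) (\<eta> c y (\<lambda>i. v (\<sigma> (p + i))))) differentiable (at x)" for v
    by (intro differentiable_sum finite_permutations finite_lessThan ballI scale)
  then show ?thesis
    unfolding form_differentiable_def wedge_def by (intro allI scale)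
qed

lemma form_differentiable_add:
  "form_differentiable \<omega> c x \<Longrightarrow> form_differentiable \<eta> c x \<Longrightarrow> form_differentiable (\<omega> + \<eta>) c x"
  by (simp add: form_differentiable_def)

lemma form_differentiable_form_map:
  "bounded_linear f \<Longrightarrow> form_differentiable \<omega> c x \<Longrightarrow> form_differentiable (form_map f \<omega>) c x"
  by (simp add: form_differentiable_def form_map_def differentiable_linear[of f])

text \<open>The product rule splits the gradient into \<open>T1\<close>, where \<omega> is
  differentiated, and \<open>T2\<close>, where \<eta> is. In \<open>T2\<close> the direction still
  precedes the \<open>p\<close> arguments of \<omega>; moving it behind them gives \<open>T3\<close>
  and the sign.\<close>

lemma ext_deriv_wedge:
  assumes m: "bounded_bilinear m" and U: "open U" "x \<in> U"
    and \<omega>: "\<And>y. y \<in> U \<Longrightarrow> alternating_form p (\<omega> c y)" "form_differentiable \<omega> c x"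
    and \<eta>: "\<And>y. y \<in> U \<Longrightarrow> alternating_form q (\<eta> c y)" "form_differentiable \<eta> c x"
  shows "ext_deriv (p + q) (wedge m p q \<omega> \<eta>) c x v =
    wedge m (Suc p) q (ext_deriv p \<omega>) \<eta> c x v + (- 1) ^ p *\<^sub>R wedge m p (Suc q) \<omega> (ext_deriv q \<eta>) c x v"
proof -
  note bil = bounded_bilinear_imp_bilinear[OF m]
  define r where "r = 1 / (fact p * fact q :: real)"
  define T where "T = (\<lambda>c x v. r *\<^sub>R m (\<omega> c x v) (\<eta> c x (\<lambda>i. v (p + i))))"
  define T1 where "T1 = (\<lambda>v. m (gradient \<omega> c x v) (\<eta> c x (\<lambda>i. v (Suc p + i))))"
  define T2 where "T2 = (\<lambda>v. m (\<omega> c x (\<lambda>i. v (Suc i)))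
    (frechet_derivative (\<lambda>y. \<eta> c y (\<lambda>i. v (Suc (p + i)))) (at x) (v 0)))"
  define T3 where "T3 = (\<lambda>v. m (\<omega> c x v) (gradient \<eta> c x (\<lambda>i. v (p + i))))"
  have diffT: "form_differentiable T c x"
    unfolding T_def form_differentiable_def
    by (intro allI differentiable_linear[OF bounded_linear_scaleR_right]
        differentiable_bilinear[OF m] form_differentiableD \<omega> \<eta>)
  have gradT: "gradient T c x = (\<lambda>v. r *\<^sub>R (T2 v + T1 v))"
    unfolding gradient_def T_def T1_def T2_def
    by (intro ext, subst frechet_derivative_linear[OF bounded_linear_scaleR_right])
      (simp_all add: frechet_derivative_bilinear[OF m] differentiable_bilinear[OF m]
        form_differentiableD[OF \<omega>(2)] form_differentiableD[OF \<eta>(2)])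
  have "wedge m p q \<omega> \<eta> = (\<lambda>c x. alternate (p + q) (T c x))"
    by (intro ext) (simp add: wedge_eq_alternate T_def r_def alternate_scaleR)
  then have lhs: "ext_deriv (p + q) (wedge m p q \<omega> \<eta>) c x v =
      r *\<^sub>R (alternate (Suc (p + q)) T2 v + alternate (Suc (p + q)) T1 v)"
    using ext_deriv_alternate[OF diffT, of "p + q" v]
    by (simp add: gradT alternate_scaleR alternate_add scaleR_add_right)
  have d\<omega>: "ext_deriv p \<omega> c x = (\<lambda>v. (1 / fact p) *\<^sub>R alternate (Suc p) (gradient \<omega> c x) v)"
    by (intro ext ext_deriv_eq_alternate[OF U \<omega>])
  have d\<eta>: "ext_deriv q \<eta> c x = (\<lambda>v. (1 / fact q) *\<^sub>R alternate (Suc q) (gradient \<eta> c x) v)"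
    by (intro ext ext_deriv_eq_alternate[OF U \<eta>])
  have "wedge m (Suc p) q (ext_deriv p \<omega>) \<eta> c x v = r *\<^sub>R alternate (Suc p + q) T1 v"
    unfolding wedge_eq_alternate d\<omega> T1_def bilinear_lmul[OF bil] alternate_scaleR
      alternate_left_block[OF bil]
    by (simp add: r_def del: fact_Suc)
  moreover have "wedge m p (Suc q) \<omega> (ext_deriv q \<eta>) c x v = r *\<^sub>R alternate (p + Suc q) T3 v"
    unfolding wedge_eq_alternate d\<eta> T3_def bilinear_rmul[OF bil] alternate_scaleR
    by (subst alternate_right_block[OF bil alternating_form_cong[OF \<omega>(1)[OF U(2)]]])
      (simp_all add: r_def del: fact_Suc)
  moreover have "alternate (Suc (p + q)) T3 v = (- 1) ^ p *\<^sub>R alternate (Suc (p + q)) T2 v"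
  proof -
    \<comment> \<open>The direction is now read from slot \<open>p\<close>, directly before the
      arguments of \<eta>.\<close>
    have "T2 (\<lambda>i. v (cycle_to_front p i)) = T3 v" for v
    proof -
      have "\<omega> c x (\<lambda>i. v (cycle_to_front p (Suc i))) = \<omega> c x v"
        using \<omega>(1)[OF U(2)] by (rule alternating_form_cong) (simp add: cycle_to_front_Suc)
      then show ?thesis
        by (simp add: T2_def T3_def gradient_def cycle_to_front_Suc)
    qed
    then show ?thesis
      using alternate_cycle_to_front[of p "Suc (p + q)" T2 v] by simp
  qed
  \<comment> \<open>The sign from \<open>T3\<close> meets the sign of the Leibniz rule, and their
    product is 1.\<close>
  ultimately show ?thesis
    by (simp add: lhs scaleR_add_right scaleR_left_commute add.commute flip: power_mult_distrib)
qed

section \<open>Nested wedge products\<close>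

text \<open>Absorbing the inner alternation gives \<open>fact (q + r)\<close>, which cancels the
  same factor in the outer normalisation. Under a single \<open>alternate\<close>, the laws of the
  structure maps can be applied to the integrand.\<close>

lemma wedge_wedge_right:
  assumes "bilinear m" and "alternating_form p (\<omega> c x)"
  shows "wedge m p (q + r) \<omega> (wedge n q r \<eta> \<zeta>) c x v = (1 / (fact p * fact q * fact r)) *\<^sub>R
    alternate (p + (q + r))
      (\<lambda>v. m (\<omega> c x v) (n (\<eta> c x (\<lambda>i. v (p + i))) (\<zeta> c x (\<lambda>i. v (p + (q + i)))))) v"
proof -
  have "wedge n q r \<eta> \<zeta> c x = (\<lambda>v. (1 / (fact q * fact r)) *\<^sub>R
      alternate (q + r) (\<lambda>v. n (\<eta> c x v) (\<zeta> c x (\<lambda>i. v (q + i)))) v)"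
    by (intro ext wedge_eq_alternate)
  then show ?thesis
    unfolding wedge_eq_alternate[of m] bilinear_rmul[OF assms(1)] alternate_scaleR
    by (simp add: alternate_right_block[OF assms(1) alternating_form_cong[OF assms(2)]]
        bilinear_rmul[OF assms(1)] alternate_scaleR)
qed

lemma wedge_wedge_left:
  assumes "bilinear m"
  shows "wedge m (p + q) r (wedge n p q \<omega> \<eta>) \<zeta> c x v = (1 / (fact p * fact q * fact r)) *\<^sub>R
    alternate (p + q + r)
      (\<lambda>v. m (n (\<omega> c x v) (\<eta> c x (\<lambda>i. v (p + i)))) (\<zeta> c x (\<lambda>i. v (p + q + i)))) v"
proof -
  have "wedge n p q \<omega> \<eta> c x = (\<lambda>v. (1 / (fact p * fact q)) *\<^sub>R
      alternate (p + q) (\<lambda>v. n (\<omega> c x v) (\<eta> c x (\<lambda>i. v (p + i)))) v)"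
    by (intro ext wedge_eq_alternate)
  then show ?thesis
    unfolding wedge_eq_alternate[of m]
    by (simp add: bilinear_lmul[OF assms] alternate_scaleR alternate_left_block[OF assms])
qed

text \<open>The argument of the one-form is moved past the \<open>q\<close> arguments of \<eta>, at
  the cost of one sign each.\<close>

lemma wedge_swap_one_form:
  assumes "\<And>v v'. (\<And>i. i < q \<Longrightarrow> v i = v' i) \<Longrightarrow> \<eta> c x v = \<eta> c x v'"
    and A: "alternating_form 1 (A c x)"
  shows "wedge m q 1 \<eta> A c x v = (- 1) ^ q *\<^sub>R wedge (\<lambda>a b. m b a) 1 q A \<eta> c x v"
proof -
  let ?T = "\<lambda>v. m (\<eta> c x (\<lambda>i. v (Suc i))) (A c x v)"
  have "?T (\<lambda>i. v (cycle_to_front q i)) = m (\<eta> c x v) (A c x (\<lambda>i. v (q + i)))" for v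
  proof -
    have "\<eta> c x (\<lambda>i. v (cycle_to_front q (Suc i))) = \<eta> c x v"
      by (rule assms(1)) (simp add: cycle_to_front_Suc)
    moreover have "A c x (\<lambda>i. v (cycle_to_front q i)) = A c x (\<lambda>i. v (q + i))"
      using A by (rule alternating_form_cong) simp
    ultimately show ?thesis by simp
  qed
  then show ?thesis
    using alternate_cycle_to_front[of q "Suc q" ?T v]
    by (simp add: wedge_eq_alternate scaleR_left_commute)
qed

lemma wedge_add_right:
  assumes "bilinear m"
  shows "wedge m p q \<omega> (\<eta> + \<zeta>) c x v = wedge m p q \<omega> \<eta> c x v + wedge m p q \<omega> \<zeta> c x v"
  by (simp add: wedge_eq_alternate bilinear_radd[OF assms] alternate_add scaleR_add_right)

lemma wedge_diff_right:
  assumes "bilinear m"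
  shows "wedge m p q \<omega> (\<eta> - \<zeta>) c x v = wedge m p q \<omega> \<eta> c x v - wedge m p q \<omega> \<zeta> c x v"
  by (simp add: wedge_eq_alternate bilinear_rsub[OF assms] alternate_diff scaleR_diff_right)

lemma wedge_add_left:
  assumes "bilinear m"
  shows "wedge m p q (\<omega> + \<eta>) \<zeta> c x v = wedge m p q \<omega> \<zeta> c x v + wedge m p q \<eta> \<zeta> c x v"
  by (simp add: wedge_eq_alternate bilinear_ladd[OF assms] alternate_add scaleR_add_right)

section \<open>The square of the exterior derivative\<close>

lemma Ck_on_2:
  assumes "Ck_on 2 U f" "x \<in> U"
  shows "f differentiable (at x)" "(\<lambda>y. frechet_derivative f (at y) u) differentiable (at x)"
  using assms by (simp_all add: numeral_2_eq_2)

lemma form_differentiable_ext_deriv: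
  assumes "x \<in> U" "\<And>v. Ck_on 2 U (\<lambda>y. \<omega> c y v)"
  shows "form_differentiable (ext_deriv k \<omega>) c x"
proof -
  have "(\<lambda>y. (- 1) ^ i *\<^sub>R frechet_derivative (\<lambda>y. \<omega> c y w) (at y) u) differentiable (at x)" for i w u
    by (rule differentiable_linear[OF bounded_linear_scaleR_right Ck_on_2(2)[OF assms(2,1)]])
  then show ?thesis
    unfolding form_differentiable_def ext_deriv_def by (intro allI differentiable_sum ballI) auto
qed

text \<open>The twofold gradient \<open>G\<close> is symmetric in its first two slots, while
  exchanging these reverses the sign of the alternation. The alternation thus equals its own
  negative.\<close>

lemma ext_deriv_ext_deriv:
  assumes U: "open U" "x \<in> U" and \<omega>: "\<And>y. y \<in> U \<Longrightarrow> alternating_form k (\<omega> c y)"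
    and smooth: "\<And>v. Ck_on 2 U (\<lambda>y. \<omega> c y v)"
  shows "ext_deriv (Suc k) (ext_deriv k \<omega>) c x v = 0"
proof -
  define T where "T = (\<lambda>c y v. (1 / fact k) *\<^sub>R gradient \<omega> c y v)"
  define G where "G = gradient T c x"
  have diff: "form_differentiable \<omega> c y" if "y \<in> U" for y
    unfolding form_differentiable_def using Ck_on_2(1)[OF smooth that] by blast
  have diff2: "(\<lambda>y. gradient \<omega> c y v) differentiable (at x)" for v
    unfolding gradient_def by (rule Ck_on_2(2)[OF smooth U(2)])
  have "ext_deriv k \<omega> c y = alternate (Suc k) (T c y)" if "y \<in> U" for y
    by (rule ext)
      (simp add: T_def alternate_scaleR ext_deriv_eq_alternate[OF U(1) that \<omega> diff[OF that]])
  then have "ext_deriv (Suc k) (ext_deriv k \<omega>) c x v =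
      ext_deriv (Suc k) (\<lambda>c x. alternate (Suc k) (T c x)) c x v"
    using form_differentiable_ext_deriv[of x U \<omega> c k] U smooth
    by (intro ext_deriv_cong[OF U]) auto
  also have "\<dots> = alternate (Suc (Suc k)) G v"
    unfolding G_def
    by (rule ext_deriv_alternate)
      (auto simp: form_differentiable_def T_def intro: differentiable_linear[OF bounded_linear_scaleR_right diff2])
  also have "\<dots> = 0"
  proof -
    have G: "G v = (1 / fact k) *\<^sub>R frechet_derivative
        (\<lambda>y. frechet_derivative (\<lambda>z. \<omega> c z (\<lambda>i. v (Suc (Suc i)))) (at y) (v 1)) (at x) (v 0)" for v
      unfolding G_def gradient_def T_def
      by (subst frechet_derivative_linear[OF bounded_linear_scaleR_right Ck_on_2(2)[OF smooth U(2)]])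
        simp
    \<comment> \<open>\<open>cycle_to_front 1\<close> is the transposition of 0 and 1.\<close>
    have "G (\<lambda>i. v (cycle_to_front 1 i)) = G v" for v
      unfolding G using symmetric_second_derivative[OF U smooth]
      by (simp add: cycle_to_front_Suc)
    then have "alternate (Suc (Suc k)) G v = - alternate (Suc (Suc k)) G v"
      using alternate_cycle_to_front[of 1 "Suc (Suc k)" G v] by simp
    then have "2 *\<^sub>R alternate (Suc (Suc k)) G v = 0"
      by (simp add: scaleR_2 eq_neg_iff_add_eq_0)
    then show ?thesis by simp
  qed
  finally show ?thesis .
qed

section \<open>Wedge identities from the Jacobi, action and derivation laws\<close>

lemma one_form_eq:
  assumes "alternating_form 1 \<eta>"
  shows "\<eta> v = \<eta> (\<lambda>_. v 0)"
  using assms by (rule alternating_form_cong) simp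

lemma wedge_scaleR_left:
  assumes "bilinear m"
  shows "wedge m p q (form_map (scaleR r) \<omega>) \<eta> c x v = r *\<^sub>R wedge m p q \<omega> \<eta> c x v"
  by (simp add: wedge_eq_alternate form_map_def bilinear_lmul[OF assms] alternate_scaleR
      scaleR_left_commute)

lemma wedge_scaleR_right:
  assumes "bilinear m"
  shows "wedge m p q \<omega> (form_map (scaleR r) \<eta>) c x v = r *\<^sub>R wedge m p q \<omega> \<eta> c x v"
  by (simp add: wedge_eq_alternate form_map_def bilinear_rmul[OF assms] alternate_scaleR
      scaleR_left_commute)

text \<open>The three terms of the Jacobi identity are cyclic rotations of one integrand. A 3-cycle
  is even, so they have equal alternations; these sum to zero.\<close>

lemma wedge_jacobi:
  fixes A :: "('m, 'e::real_vector, 'g::real_normed_vector) form"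
  assumes "lie_algebra br" and A: "alternating_form 1 (A c x)"
  shows "wedge br 1 2 A (wedge br 1 1 A A) c x v = 0"
proof -
  interpret lie_algebra br by fact
  define a where "a u = A c x (\<lambda>_. u)" for u
  define T where "T v = br (a (v 0)) (br (a (v 1)) (a (v 2)))" for v :: "nat \<Rightarrow> 'e"
  have eq: "A c x v = a (v 0)" for v
    using one_form_eq[OF A] by (simp add: a_def)
  have cyc: "alternate 3 (\<lambda>v. S (\<lambda>i. v (cycle_to_front 2 i))) v = alternate 3 S v" for S
    using alternate_cycle_to_front[of 2 3 S v] by simp
  have perm: "(\<lambda>i. v (cycle_to_front 2 i)) 0 = v 2" "(\<lambda>i. v (cycle_to_front 2 i)) 1 = v 0"
    "(\<lambda>i. v (cycle_to_front 2 i)) 2 = v 1" for v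
    by (simp_all add: cycle_to_front_def numeral_2_eq_2)
  define T' where "T' v = br (a (v 2)) (br (a (v 0)) (a (v 1)))" for v :: "nat \<Rightarrow> 'e"
  define T'' where "T'' v = br (a (v 1)) (br (a (v 2)) (a (v 0)))" for v :: "nat \<Rightarrow> 'e"
  have "alternate 3 T' v = alternate 3 T v"
    using cyc[of T] unfolding T_def T'_def perm .
  moreover have "alternate 3 T'' v = alternate 3 T' v"
    using cyc[of T'] unfolding T'_def T''_def perm .
  moreover have "alternate 3 T v + alternate 3 T'' v + alternate 3 T' v = 0"
    unfolding alternate_add[symmetric] T_def T'_def T''_def jacobi
    by (simp add: alternate_def)
  ultimately have "3 *\<^sub>R alternate 3 T v = 0"
    using scaleR_left_distrib[of 2 1 "alternate 3 T v"] by (simp add: scaleR_2)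
  moreover have "wedge br 1 2 A (wedge br 1 1 A A) c x v = alternate 3 T v"
    using wedge_wedge_right[of br 1 A c x 1 1 br A A v, OF bilinear_bracket A]
    by (simp add: eq T_def[abs_def] numeral_2_eq_2 numeral_3_eq_3)
  ultimately show ?thesis by simp
qed

text \<open>The two terms of the commutator differ by exchanging the arguments of the two copies of
  \<open>A\<close>. This is odd, so after alternation they add up; the resulting 2 cancels the 1/2
  in the definition of \<open>A \<and> A\<close>.\<close>

lemma wedge_action:
  assumes "bilinear act" "\<And>X X' Y. act (br X X') Y = act X (act X' Y) - act X' (act X Y)"
    and A: "alternating_form 1 (A c x)"
  shows "wedge act 2 q (wedge br 1 1 A A) \<eta> c x v =
    2 *\<^sub>R wedge act 1 (Suc q) A (wedge act 1 q A \<eta>) c x v"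
proof -
  define a where "a u = A c x (\<lambda>_. u)" for u
  have eq: "A c x v = a (v 0)" for v
    using one_form_eq[OF A] by (simp add: a_def)
  define T where "T v = act (a (v 0)) (act (a (v 1)) (\<eta> c x (\<lambda>i. v (2 + i))))" for v
  define T' where "T' v = act (a (v 1)) (act (a (v 0)) (\<eta> c x (\<lambda>i. v (2 + i))))" for v
  have "T (\<lambda>i. v (cycle_to_front 1 i)) = T' v" for v
    by (simp add: T_def T'_def cycle_to_front_Suc)
  then have "alternate (2 + q) T' v = - alternate (2 + q) T v"
    using alternate_cycle_to_front[of 1 "2 + q" T v] by simp
  moreover have "wedge act 2 q (wedge br 1 1 A A) \<eta> c x v =
      (1 / fact q) *\<^sub>R (alternate (2 + q) T v - alternate (2 + q) T' v)"
    using wedge_wedge_left[OF assms(1), of 1 1 q br A A \<eta> c x v]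
    by (simp add: eq assms(2) T_def[abs_def] T'_def[abs_def] numeral_2_eq_2 alternate_diff)
  moreover have "wedge act 1 (Suc q) A (wedge act 1 q A \<eta>) c x v =
      (1 / fact q) *\<^sub>R alternate (2 + q) T v"
    using wedge_wedge_right[of act 1 A c x 1 q act A \<eta> v, OF assms(1) A]
    by (simp add: eq T_def[abs_def] numeral_2_eq_2)
  ultimately show ?thesis by (simp flip: scaleR_2)
qed

text \<open>The algebraic counterpart of the Leibniz rule: in the second term \<open>A\<close> must
  pass the \<open>p\<close> arguments of \<omega>, hence the sign.\<close>

lemma wedge_derivation:
  assumes "bilinear act" "bilinear m"
    and deriv: "\<And>X Y Y'. act X (m Y Y') = m (act1 X Y) Y' + m Y (act2 X Y')"
    and A: "alternating_form 1 (A c x)" and \<omega>: "alternating_form p (\<omega> c x)"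
  shows "wedge act 1 (p + q) A (wedge m p q \<omega> \<eta>) c x v =
    wedge m (Suc p) q (wedge act1 1 p A \<omega>) \<eta> c x v
      + (- 1) ^ p *\<^sub>R wedge m p (Suc q) \<omega> (wedge act2 1 q A \<eta>) c x v"
proof -
  define a where "a u = A c x (\<lambda>_. u)" for u
  have eq: "A c x v = a (v 0)" for v
    using one_form_eq[OF A] by (simp add: a_def)
  define S1 where "S1 v = m (act1 (a (v 0)) (\<omega> c x (\<lambda>i. v (Suc i)))) (\<eta> c x (\<lambda>i. v (Suc (p + i))))" for v
  define S2 where "S2 v = m (\<omega> c x (\<lambda>i. v (Suc i))) (act2 (a (v 0)) (\<eta> c x (\<lambda>i. v (Suc (p + i)))))" for v
  define S3 where "S3 v = m (\<omega> c x v) (act2 (a (v p)) (\<eta> c x (\<lambda>i. v (Suc (p + i)))))" for v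
  define r where "r = 1 / (fact p * fact q :: real)"
  have "S2 (\<lambda>i. v (cycle_to_front p i)) = S3 v" for v
  proof -
    have "\<omega> c x (\<lambda>i. v (cycle_to_front p (Suc i))) = \<omega> c x v"
      using \<omega> by (rule alternating_form_cong) (simp add: cycle_to_front_Suc)
    then show ?thesis
      by (simp add: S2_def S3_def cycle_to_front_Suc)
  qed
  then have "alternate (Suc (p + q)) S3 v = (- 1) ^ p *\<^sub>R alternate (Suc (p + q)) S2 v"
    using alternate_cycle_to_front[of p "Suc (p + q)" S2 v] by simp
  moreover have "wedge act 1 (p + q) A (wedge m p q \<omega> \<eta>) c x v =
      r *\<^sub>R (alternate (Suc (p + q)) S1 v + alternate (Suc (p + q)) S2 v)"
    using wedge_wedge_right[of act 1 A c x p q m \<omega> \<eta> v, OF assms(1) A]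
    by (simp add: eq deriv r_def S1_def[abs_def] S2_def[abs_def] alternate_add)
  moreover have "wedge m (Suc p) q (wedge act1 1 p A \<omega>) \<eta> c x v = r *\<^sub>R alternate (Suc (p + q)) S1 v"
    using wedge_wedge_left[OF assms(2), of 1 p q act1 A \<omega> \<eta> c x v]
    by (simp add: eq r_def S1_def[abs_def])
  moreover have "wedge m p (Suc q) \<omega> (wedge act2 1 q A \<eta>) c x v = r *\<^sub>R alternate (Suc (p + q)) S3 v"
    using wedge_wedge_right[of m p \<omega> c x 1 q act2 A \<eta> v, OF assms(2) \<omega>]
    by (simp add: eq r_def S3_def[abs_def])
  ultimately show ?thesis
    by (simp add: scaleR_add_right scaleR_left_commute flip: power_mult_distrib)
qed

lemma form_apply_eqs:
  "(\<omega> + \<eta>) c x v = \<omega> c x v + \<eta> c x v" "(\<omega> - \<eta>) c x v = \<omega> c x v - \<eta> c x v"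
  "(- \<omega>) c x v = - \<omega> c x v" "form_map f \<omega> c x v = f (\<omega> c x v)"
  by (simp_all add: form_map_def)

lemma ext_deriv_wedge_one_form:
  assumes "bounded_bilinear m" "open U" "x \<in> U"
    and "\<And>y. y \<in> U \<Longrightarrow> alternating_form 1 (A c y)" "form_differentiable A c x"
    and "\<And>y. y \<in> U \<Longrightarrow> alternating_form q (\<eta> c y)" "form_differentiable \<eta> c x"
  shows "ext_deriv (Suc q) (wedge m 1 q A \<eta>) c x v =
    wedge m 2 q (ext_deriv 1 A) \<eta> c x v - wedge m 1 (Suc q) A (ext_deriv q \<eta>) c x v"
  using ext_deriv_wedge[OF assms, of v] by (simp add: numeral_2_eq_2)

text \<open>Lifts equivariance of \<alpha> and \<beta> from Lie algebra elements to forms.\<close>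

lemma wedge_form_map_right:
  assumes "\<And>a b. m a (f b) = f (m' a b)" "linear f"
  shows "wedge m p q \<omega> (form_map f \<eta>) c x v = f (wedge m' p q \<omega> \<eta> c x v)"
  by (simp add: wedge_def form_map_def assms(1) linear_scale[OF assms(2)] linear_sum[OF assms(2)])

section \<open>The Bianchi identities\<close>

context differential_2_crossed_module
begin

text \<open>Finite dimension makes the structure maps continuous, as the product rule
  requires.\<close>

lemma bounded_bilinear_structure:
  "bounded_bilinear lie_g" "bounded_bilinear act_h" "bounded_bilinear act_l" "bounded_bilinear peiffer"
  using G.finite_dimensional H.finite_dimensional L.finite_dimensional
    G.bilinear_bracket action_l action_h bilinear_peiffer
  by (auto intro!: finite_dimensional_bounded_bilinear simp: lie_action_by_derivations_def)

lemmas bilinear_structure = bounded_bilinear_structure[THEN bounded_bilinear_imp_bilinear]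

lemma linear_structure: "linear \<alpha>" "linear \<beta>"
  using hom_\<alpha> hom_\<beta> by (simp_all add: lie_hom_def)

lemma bounded_linear_structure: "bounded_linear \<alpha>" "bounded_linear \<beta>"
  by (rule finite_dimensional_bounded_linear[OF H.finite_dimensional linear_structure(1)],
      rule finite_dimensional_bounded_linear[OF L.finite_dimensional linear_structure(2)])

lemma lie_g_antisym: "lie_g b a = - lie_g a b"
  using G.bracket_self[of "a + b"]
  unfolding bilinear_ladd[OF G.bilinear_bracket] bilinear_radd[OF G.bilinear_bracket]
  by (simp add: G.bracket_self eq_neg_iff_add_eq_0 add.commute)

text \<open>The identities at one point of one chart. In each, the exterior derivative and the wedge
  with \<open>A\<close> are expanded separately, and the terms where \<open>A\<close> meets a
  derivative cancel in the sum.\<close>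

lemma bianchi_identities_at:
  fixes A F1 :: "('m, 'e::euclidean_space, 'g) form"
    and B F2 :: "('m, 'e, 'h) form" and C \<Omega>3 :: "('m, 'e, 'l) form"
  assumes U: "open U" "x \<in> U"
    and alt: "\<And>y. y \<in> U \<Longrightarrow> alternating_form 1 (A c y)"
      "\<And>y. y \<in> U \<Longrightarrow> alternating_form 2 (B c y)" "\<And>y. y \<in> U \<Longrightarrow> alternating_form 3 (C c y)"
    and smooth: "\<And>v. Ck_on 2 U (\<lambda>y. A c y v)" "\<And>v. Ck_on 2 U (\<lambda>y. B c y v)"
      "\<And>v. Ck_on 2 U (\<lambda>y. C c y v)"
    and F1: "F1 = ext_deriv 1 A + form_map (scaleR (1 / 2)) (wedge lie_g 1 1 A A) - form_map \<alpha> B"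
    and F2: "F2 = ext_deriv 2 B + wedge act_h 1 2 A B - form_map \<beta> C"
    and \<Omega>3: "\<Omega>3 = ext_deriv 3 C + wedge act_l 1 3 A C + wedge peiffer 2 2 B B"
  shows "(ext_deriv 2 F1 + wedge lie_g 1 2 A F1) c x v = (- form_map \<alpha> F2) c x v"
    and "(ext_deriv 3 F2 + wedge act_h 1 3 A F2) c x v =
      (wedge act_h 2 2 (F1 + form_map \<alpha> B) B - form_map \<beta> (\<Omega>3 - wedge peiffer 2 2 B B)) c x v"
    and "(ext_deriv 4 \<Omega>3 + wedge act_l 1 4 A \<Omega>3) c x v =
      (wedge act_l 2 3 (F1 + form_map \<alpha> B) C + wedge peiffer 3 2 (F2 + form_map \<beta> C) B
        + wedge peiffer 2 3 B (F2 + form_map \<beta> C)) c x v"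
proof -
  note bb = bounded_bilinear_structure and bil = bilinear_structure
    and lin = linear_structure and bl = bounded_linear_structure
  note half = bounded_linear_scaleR_right[of "1 / 2 :: real"]
  have diff: "form_differentiable A c x" "form_differentiable B c x" "form_differentiable C c x"
    unfolding form_differentiable_def
    using Ck_on_2(1)[OF smooth(1) U(2)] Ck_on_2(1)[OF smooth(2) U(2)] Ck_on_2(1)[OF smooth(3) U(2)]
    by blast+
  have diff_d: "form_differentiable (ext_deriv 1 A) c x" "form_differentiable (ext_deriv 2 B) c x"
    "form_differentiable (ext_deriv 3 C) c x"
    using form_differentiable_ext_deriv[OF U(2), of A c] form_differentiable_ext_deriv[OF U(2), of B c]
      form_differentiable_ext_deriv[OF U(2), of C c] smooth by blast+
  have dd: "ext_deriv 2 (ext_deriv 1 A) c x v = 0" "ext_deriv 3 (ext_deriv 2 B) c x v = 0"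
    "ext_deriv 4 (ext_deriv 3 C) c x v = 0"
    using ext_deriv_ext_deriv[of U x 1 A c v, OF U alt(1) smooth(1)]
      ext_deriv_ext_deriv[of U x 2 B c v, OF U alt(2) smooth(2)]
      ext_deriv_ext_deriv[of U x 3 C c v, OF U alt(3) smooth(3)] by (simp_all add: eval_nat_numeral)
  note diff_wedge = form_differentiable_wedge[OF bb(1) diff(1) diff(1)]
    form_differentiable_wedge[OF bb(2) diff(1) diff(2)] form_differentiable_wedge[OF bb(3) diff(1) diff(3)]
    form_differentiable_wedge[OF bb(4) diff(2) diff(2)]
  have act_bracket: "act_h (lie_g X X') Y = act_h X (act_h X' Y) - act_h X' (act_h X Y)"
    "act_l (lie_g X X') Z = act_l X (act_l X' Z) - act_l X' (act_l X Z)" for X X' Y Z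
    using action_h action_l by (simp_all add: lie_action_by_derivations_def)

  define dA where "dA = ext_deriv 1 A"
  define dB where "dB = ext_deriv 2 B"
  define dC where "dC = ext_deriv 3 C"
  define AA where "AA = wedge lie_g 1 1 A A"

  \<comment> \<open>Leibniz gives \<open>dA \<and> A - A \<and> dA\<close>. Moving \<open>A\<close>
    past the two arguments of \<open>dA\<close> costs no sign, but reversing the bracket does, so
    both terms are \<open>- A \<and> dA\<close>.\<close>
  have dAA: "ext_deriv 2 AA c x v = - 2 *\<^sub>R wedge lie_g 1 2 A dA c x v"
  proof -
    have "dA c x w = dA c x w'" if "\<And>i. i < 2 \<Longrightarrow> w i = w' i" for w w'
      unfolding dA_def
      by (rule ext_deriv_depends[of U x 1 A c, OF U alt(1) diff(1)]) (use that in auto)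
    then have "wedge lie_g 2 1 dA A c x v = (- 1) ^ 2 *\<^sub>R wedge (\<lambda>a b. lie_g b a) 1 2 A dA c x v"
      by (rule wedge_swap_one_form[of 2 dA c x A lie_g v, OF _ alt(1)[OF U(2)]])
    then have "wedge lie_g 2 1 dA A c x v = wedge (\<lambda>a b. lie_g b a) 1 2 A dA c x v"
      by (simp only: power2_minus power_one scaleR_one)
    also have "\<dots> = - wedge lie_g 1 2 A dA c x v"
    proof -
      have "(\<lambda>a b. lie_g b a) = (\<lambda>a b. - lie_g a b)"
        by (intro ext lie_g_antisym)
      then show ?thesis by (simp add: wedge_def sum_negf)
    qed
    finally show ?thesis
      using ext_deriv_wedge_one_form[of lie_g U x A c 1 A v, OF bb(1) U alt(1) diff(1) alt(1) diff(1)]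
      by (simp add: AA_def dA_def numeral_2_eq_2 scaleR_2)
  qed
  have dAB: "ext_deriv 3 (wedge act_h 1 2 A B) c x v = wedge act_h 2 2 dA B c x v - wedge act_h 1 3 A dB c x v"
    using ext_deriv_wedge_one_form[of act_h U x A c 2 B v, OF bb(2) U alt(1) diff(1) alt(2) diff(2)]
    by (simp add: dA_def dB_def)
  have dAC: "ext_deriv 4 (wedge act_l 1 3 A C) c x v = wedge act_l 2 3 dA C c x v - wedge act_l 1 4 A dC c x v"
    using ext_deriv_wedge_one_form[of act_l U x A c 3 C v, OF bb(3) U alt(1) diff(1) alt(3) diff(3)]
    by (simp add: dA_def dC_def)
  have dBB: "ext_deriv 4 (wedge peiffer 2 2 B B) c x v = wedge peiffer 3 2 dB B c x v + wedge peiffer 2 3 B dB c x v"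
    using ext_deriv_wedge[of peiffer U x 2 B c 2 B v, OF bb(4) U alt(2) diff(2) alt(2) diff(2)]
    by (simp add: dB_def)
  have AAA: "wedge lie_g 1 2 A AA c x v = 0"
    unfolding AA_def by (rule wedge_jacobi[of lie_g A c x v, OF G.lie_algebra_axioms alt(1)[OF U(2)]])
  have AAB: "wedge act_h 2 2 AA B c x v = 2 *\<^sub>R wedge act_h 1 3 A (wedge act_h 1 2 A B) c x v"
    using wedge_action[of act_h lie_g A c x 2 B v, OF bil(2) act_bracket(1) alt(1)[OF U(2)]]
    by (simp add: AA_def)
  have AAC: "wedge act_l 2 3 AA C c x v = 2 *\<^sub>R wedge act_l 1 4 A (wedge act_l 1 3 A C) c x v"
    using wedge_action[of act_l lie_g A c x 3 C v, OF bil(3) act_bracket(2) alt(1)[OF U(2)]]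
    by (simp add: AA_def)
  \<comment> \<open>The derivation law is equivariance of the Peiffer lifting; the sign is positive
    since \<open>B\<close> has even degree.\<close>
  have ABB: "wedge act_l 1 4 A (wedge peiffer 2 2 B B) c x v =
      wedge peiffer 3 2 (wedge act_h 1 2 A B) B c x v + wedge peiffer 2 3 B (wedge act_h 1 2 A B) c x v"
    using wedge_derivation[of act_l peiffer act_h act_h A c x 2 B 2 B v,
        OF bil(3,4) equivariant_peiffer alt(1)[OF U(2)] alt(2)[OF U(2)]]
    by simp
  have A\<alpha>B: "wedge lie_g 1 2 A (form_map \<alpha> B) c x v = \<alpha> (wedge act_h 1 2 A B c x v)"
    by (rule wedge_form_map_right[where m = lie_g and f = \<alpha> and m' = act_h, OF equivariant_\<alpha>[symmetric] lin(1)])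
  have A\<beta>C: "wedge act_h 1 3 A (form_map \<beta> C) c x v = \<beta> (wedge act_l 1 3 A C c x v)"
    by (rule wedge_form_map_right[where m = act_h and f = \<beta> and m' = act_l, OF equivariant_\<beta>[symmetric] lin(2)])
  \<comment> \<open>The corrections on the right-hand sides of the identities undo the subtracted
    \<alpha> and \<beta> terms and the Peiffer term.\<close>
  have curv: "F1 + form_map \<alpha> B = dA + form_map (scaleR (1 / 2)) AA"
    "F2 + form_map \<beta> C = dB + wedge act_h 1 2 A B"
    "\<Omega>3 - wedge peiffer 2 2 B B = dC + wedge act_l 1 3 A C"
    by (simp_all add: F1 F2 \<Omega>3 dA_def dB_def dC_def AA_def)

  have "ext_deriv 2 F1 c x v = (1 / 2) *\<^sub>R ext_deriv 2 AA c x v - \<alpha> (dB c x v)"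
    unfolding F1 AA_def
    by (simp only: ext_deriv_diff ext_deriv_add ext_deriv_form_map[OF half] ext_deriv_form_map[OF bl(1)]
        form_differentiable_add form_differentiable_form_map[OF half] form_differentiable_form_map[OF bl(1)]
        diff diff_d diff_wedge dd dB_def add_0)
  moreover have "wedge lie_g 1 2 A F1 c x v = wedge lie_g 1 2 A dA c x v - \<alpha> (wedge act_h 1 2 A B c x v)"
    unfolding F1 wedge_diff_right[OF bil(1)] wedge_add_right[OF bil(1)] wedge_scaleR_right[OF bil(1)]
      A\<alpha>B AA_def[symmetric] AAA dA_def by simp
  \<comment> \<open>Half of \<open>dAA\<close> cancels \<open>A \<and> dA\<close>; the term
    \<alpha>(\<beta>(C)) inside \<alpha>(F2) vanishes.\<close>
  ultimately show "(ext_deriv 2 F1 + wedge lie_g 1 2 A F1) c x v = (- form_map \<alpha> F2) c x v"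
    by (simp add: form_apply_eqs F2 dAA dB_def linear_add[OF lin(1)] linear_diff[OF lin(1)] \<alpha>_\<beta>)

  have "ext_deriv 3 F2 c x v = wedge act_h 2 2 dA B c x v - wedge act_h 1 3 A dB c x v - \<beta> (dC c x v)"
    unfolding F2
    by (simp only: ext_deriv_diff ext_deriv_add ext_deriv_form_map[OF bl(2)]
        form_differentiable_add form_differentiable_form_map[OF bl(2)]
        diff diff_d diff_wedge dd dAB dC_def add_0)
  \<comment> \<open>By \<open>AAB\<close> the double action of \<open>A\<close> on \<open>B\<close>
    appears as half of \<open>AA\<close> acting on \<open>B\<close>, the curvature part of
    \<open>F1\<close>.\<close>
  moreover have "wedge act_h 1 3 A F2 c x v = wedge act_h 1 3 A dB c x v
      + (1 / 2) *\<^sub>R wedge act_h 2 2 AA B c x v - \<beta> (wedge act_l 1 3 A C c x v)"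
    unfolding F2 wedge_diff_right[OF bil(2)] wedge_add_right[OF bil(2)] A\<beta>C AAB dB_def by simp
  ultimately show "(ext_deriv 3 F2 + wedge act_h 1 3 A F2) c x v =
      (wedge act_h 2 2 (F1 + form_map \<alpha> B) B - form_map \<beta> (\<Omega>3 - wedge peiffer 2 2 B B)) c x v"
    by (simp add: form_apply_eqs curv wedge_add_left[OF bil(2)] wedge_scaleR_left[OF bil(2)]
        linear_add[OF lin(2)])

  have "ext_deriv 4 \<Omega>3 c x v = wedge act_l 2 3 dA C c x v - wedge act_l 1 4 A dC c x v
      + (wedge peiffer 3 2 dB B c x v + wedge peiffer 2 3 B dB c x v)"
    unfolding \<Omega>3
    by (simp only: ext_deriv_add form_differentiable_add diff diff_d diff_wedge dd dAC dBB add_0)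
  moreover have "wedge act_l 1 4 A \<Omega>3 c x v = wedge act_l 1 4 A dC c x v
      + (1 / 2) *\<^sub>R wedge act_l 2 3 AA C c x v
      + (wedge peiffer 3 2 (wedge act_h 1 2 A B) B c x v + wedge peiffer 2 3 B (wedge act_h 1 2 A B) c x v)"
    unfolding \<Omega>3 wedge_add_right[OF bil(3)] ABB AAC dC_def by simp
  \<comment> \<open>The terms \<open>dB\<close> from Leibniz and \<open>A \<and> B\<close> from
    equivariance combine in each Peiffer slot to \<open>F2 + form_map \<beta> C\<close>.\<close>
  ultimately show "(ext_deriv 4 \<Omega>3 + wedge act_l 1 4 A \<Omega>3) c x v =
      (wedge act_l 2 3 (F1 + form_map \<alpha> B) C + wedge peiffer 3 2 (F2 + form_map \<beta> C) B
        + wedge peiffer 2 3 B (F2 + form_map \<beta> C)) c x v"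
    by (simp add: form_apply_eqs curv wedge_add_left[OF bil(3)] wedge_scaleR_left[OF bil(3)]
        wedge_add_left[OF bil(4)] wedge_add_right[OF bil(4)])
qed

end

theorem theorem1:
  fixes lie_l :: "'l::real_normed_vector \<Rightarrow> 'l \<Rightarrow> 'l"
    and lie_h :: "'h::real_normed_vector \<Rightarrow> 'h \<Rightarrow> 'h"
    and lie_g :: "'g::real_normed_vector \<Rightarrow> 'g \<Rightarrow> 'g"
    and \<beta> :: "'l \<Rightarrow> 'h" and \<alpha> :: "'h \<Rightarrow> 'g"
    and act_l :: "'g \<Rightarrow> 'l \<Rightarrow> 'l" and act_h :: "'g \<Rightarrow> 'h \<Rightarrow> 'h"
    and peiffer :: "'h \<Rightarrow> 'h \<Rightarrow> 'l"
    and X :: "'m topology" and \<A> :: "('m, 'e::euclidean_space) chart set"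
    and A F1 :: "('m, 'e, 'g) form"
    and B F2 :: "('m, 'e, 'h) form"
    and C \<Omega>3 :: "('m, 'e, 'l) form"
  assumes crossed: "differential_2_crossed_module lie_l lie_h lie_g \<beta> \<alpha> act_l act_h peiffer"
    and manifold: "smooth_manifold X \<A>"
    and dim: "DIM('e) \<ge> 4"
    and A: "differential_form \<A> 1 A"
    and B: "differential_form \<A> 2 B"
    and C: "differential_form \<A> 3 C"
    and F1: "F1 = ext_deriv 1 A + form_map (scaleR (1 / 2)) (wedge lie_g 1 1 A A) - form_map \<alpha> B"
    and F2: "F2 = ext_deriv 2 B + wedge act_h 1 2 A B - form_map \<beta> C"
    and \<Omega>3: "\<Omega>3 = ext_deriv 3 C + wedge act_l 1 3 A C + wedge peiffer 2 2 B B"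
  shows "form_eq \<A> (ext_deriv 2 F1 + wedge lie_g 1 2 A F1) (- form_map \<alpha> F2) \<and>
    form_eq \<A> (ext_deriv 3 F2 + wedge act_h 1 3 A F2)
          (wedge act_h 2 2 (F1 + form_map \<alpha> B) B - form_map \<beta> (\<Omega>3 - wedge peiffer 2 2 B B)) \<and>
    form_eq \<A> (ext_deriv 4 \<Omega>3 + wedge act_l 1 4 A \<Omega>3)
          (wedge act_l 2 3 (F1 + form_map \<alpha> B) C
            + wedge peiffer 3 2 (F2 + form_map \<beta> C) B
            + wedge peiffer 2 3 B (F2 + form_map \<beta> C))"
proof -
  interpret differential_2_crossed_module lie_l lie_h lie_g \<beta> \<alpha> act_l act_h peiffer
    by (rule crossed)
  have alt: "alternating_form 1 (A c y)" "alternating_form 2 (B c y)" "alternating_form 3 (C c y)"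
    if "c \<in> \<A>" "y \<in> chart_image c" for c y
    using A B C that by (simp_all add: differential_form_def)
  have smooth: "Ck_on 2 (chart_image c) (\<lambda>y. A c y v)" "Ck_on 2 (chart_image c) (\<lambda>y. B c y v)"
    "Ck_on 2 (chart_image c) (\<lambda>y. C c y v)" if "c \<in> \<A>" for c v
    using A B C that by (simp_all add: differential_form_def smooth_on_def)
  \<comment> \<open>Equality of forms is tested chart by chart, and each chart image is an open set
    on which the local identities apply.\<close>
  note bianchi = bianchi_identities_at[where U = "chart_image c" and A = A and B = B and C = C and c = c
      and x = x and v = v for c x v, OF smooth_manifold.chart_image_open[OF manifold] _
      alt(1) alt(2) alt(3) smooth(1) smooth(2) smooth(3) F1 F2 \<Omega>3]
  show ?thesis
    unfolding form_eq_def
    by (intro conjI ballI ext) (rule bianchi; assumption)+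
qed

end
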